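(* Let $\Gamma$ be an infinite finitely generated abelian group and $F$ an injective endomorphism of $\Gamma$ such that $\Gamma$ admits an $F^r$-spanning set for some $r>0$. If $A\subseteq\Gamma$ is $F$-sparse and stable in $\Gamma$, then $A$ is a finite Boolean combination of groupless $F$-sets.
   Context: For a string $\sigma=s_0\cdots s_n$ of elements of $\Gamma$ and an endomorphism $G$, $[\sigma]_G=s_0+Gs_1+\cdots+G^ns_n$; $[L]_G=\{[\sigma]_G:\sigma\in L\}$. $\Lambda^*$ denotes finite strings over $\Lambda$. A finite $\Sigma\subseteq\Gamma$ is a $G$-spanning set if: (i) every $a\in\Gamma$ equals $[\sigma]_G$ for some $\sigma\in\Sigma^*$; (ii) $0\in\Sigma$ and $\Sigma=-\Sigma$; (iii) for $a_1,\dots,a_5\in\Sigma$, $a_1+\cdots+a_5\in\Sigma+G\Sigma$; (iv) if $a_1,a_2,a_3\in\Sigma$ and $a_1+a_2+a_3\in G\Gamma$ then $a_1+a_2+a_3\in G\Sigma$. A language is sparse if it is regular and the number of its words of length $\le x$ is bounded by a polynomial in $x$. $A$ is $F$-sparse if there are $r'>0$, an $F^{r'}$-spanning set $\Sigma$ and a sparse $L\subseteq\Sigma^*$ with $A=[L]_{F^{r'}}$. $A$ is stable in $\Gamma$ if there is no bound-free family of tuples: i.e. there is $N$ such that there are no $a_1,\dots,a_N,b_1,\dots,b_N\in\Gamma$ with $a_i+b_j\in A\iff i\le j$ for all $i,j\le N$. An $F$-cycle is a set $C(a;F^\delta)=\{a+F^\delta a+\cdots+F^{\delta n}a:n<\omega\}$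 with $a\in\Gamma$, $\delta>0$. A groupless $F$-set is a finite union of sets of the form $\gamma+C(a_1;F^{r_1})+\cdots+C(a_n;F^{r_n})$ with $\gamma,a_i\in\Gamma$ and $r_i>0$. *)

theory Defs
  imports
    "HOL-Library.Set_Algebras"
    "HOL-Computational_Algebra.Polynomial"
    "HOL-Computational_Algebra.Group_Closure"
begin

text \<open>
  The ambient group is the universe of a type of class \<open>ab_group_add\<close>. Sums of sets are the
  elementwise ones of \<open>Set_Algebras\<close>; note that \<open>- A\<close> on sets is the complement, so that the set
  of negatives is written \<open>uminus ` A\<close>.
\<close>

definition finitely_generated :: "'a::ab_group_add itself \<Rightarrow> bool"
  where "finitely_generated _ \<longleftrightarrow> (\<exists>S::'a set. finite S \<and> group_closure S = UNIV)"

definition string_value :: "('a::ab_group_add \<Rightarrow> 'a) \<Rightarrow> 'a list \<Rightarrow> 'a"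
  where "string_value G \<sigma> = (\<Sum>i<length \<sigma>. (G ^^ i) (\<sigma> ! i))"

definition spanning_set :: "('a::ab_group_add \<Rightarrow> 'a) \<Rightarrow> 'a set \<Rightarrow> bool"
  where "spanning_set G \<Sigma> \<longleftrightarrow>
    finite \<Sigma> \<and>
    (\<forall>a. \<exists>\<sigma>\<in>lists \<Sigma>. a = string_value G \<sigma>) \<and>
    0 \<in> \<Sigma> \<and> \<Sigma> = uminus ` \<Sigma> \<and>
    (\<forall>a\<^sub>1\<in>\<Sigma>. \<forall>a\<^sub>2\<in>\<Sigma>. \<forall>a\<^sub>3\<in>\<Sigma>. \<forall>a\<^sub>4\<in>\<Sigma>. \<forall>a\<^sub>5\<in>\<Sigma>.
       a\<^sub>1 + a\<^sub>2 + a\<^sub>3 + a\<^sub>4 + a\<^sub>5 \<in> \<Sigma> + G ` \<Sigma>) \<and>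
    (\<forall>a\<^sub>1\<in>\<Sigma>. \<forall>a\<^sub>2\<in>\<Sigma>. \<forall>a\<^sub>3\<in>\<Sigma>.
       a\<^sub>1 + a\<^sub>2 + a\<^sub>3 \<in> range G \<longrightarrow> a\<^sub>1 + a\<^sub>2 + a\<^sub>3 \<in> G ` \<Sigma>)"

text \<open>
  Regularity over the finite alphabet \<open>\<Lambda>\<close> is recognizability by a complete deterministic finite
  automaton with state set \<open>Q\<close>, initial state \<open>q\<^sub>0\<close>, accepting states \<open>T\<close> and transition
  function \<open>\<delta>\<close>. Taking states in \<open>nat\<close> is no restriction, as \<open>Q\<close> is finite.
\<close>

definition regular_language :: "'a set \<Rightarrow> 'a list set \<Rightarrow> bool"
  where "regular_language \<Lambda> L \<longleftrightarrow>
    finite \<Lambda> \<and>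
    (\<exists>(Q::nat set) q\<^sub>0 T \<delta>.
       finite Q \<and> q\<^sub>0 \<in> Q \<and> T \<subseteq> Q \<and> (\<forall>q\<in>Q. \<forall>s\<in>\<Lambda>. \<delta> q s \<in> Q) \<and>
       L = {w \<in> lists \<Lambda>. foldl \<delta> q\<^sub>0 w \<in> T})"

definition sparse_language :: "'a set \<Rightarrow> 'a list set \<Rightarrow> bool"
  where "sparse_language \<Lambda> L \<longleftrightarrow>
    regular_language \<Lambda> L \<and>
    (\<exists>p::real poly. \<forall>x::nat. real (card {w \<in> L. length w \<le> x}) \<le> poly p (real x))"

definition F_sparse :: "('a::ab_group_add \<Rightarrow> 'a) \<Rightarrow> 'a set \<Rightarrow> bool"
  where "F_sparse F A \<longleftrightarrow>
    (\<exists>r>0. \<exists>\<Sigma> L. spanning_set (F ^^ r) \<Sigma> \<and> sparse_language \<Sigma> L \<and>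
       A = string_value (F ^^ r) ` L)"

definition stable_set :: "'a::ab_group_add set \<Rightarrow> bool"
  where "stable_set A \<longleftrightarrow>
    (\<exists>N::nat. \<not> (\<exists>a b :: nat \<Rightarrow> 'a.
       \<forall>i\<in>{1..N}. \<forall>j\<in>{1..N}. a i + b j \<in> A \<longleftrightarrow> i \<le> j))"

text \<open>\<open>F_cycle F d a\<close> is the cycle \<open>C(a; F\<^sup>d)\<close>, which is only considered for \<open>d > 0\<close>.\<close>

definition F_cycle :: "('a::ab_group_add \<Rightarrow> 'a) \<Rightarrow> nat \<Rightarrow> 'a \<Rightarrow> 'a set"
  where "F_cycle F d a = {\<Sum>i\<le>n. (F ^^ (d * i)) a | n. True}"

text \<open>
  A summand list \<open>cs\<close> of pairs \<open>(a, r)\<close> may be empty, which gives the singleton \<open>{\<gamma>}\<close>; this adds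
  nothing, since \<open>{\<gamma>} = \<gamma> + C(0; F)\<close> for additive \<open>F\<close>.
\<close>

definition groupless_F_set :: "('a::ab_group_add \<Rightarrow> 'a) \<Rightarrow> 'a set \<Rightarrow> bool"
  where "groupless_F_set F A \<longleftrightarrow>
    (\<exists>\<A>. finite \<A> \<and> A = \<Union>\<A> \<and>
       (\<forall>B\<in>\<A>. \<exists>\<gamma> cs. (\<forall>(a, r)\<in>set cs. r > 0) \<and>
          B = {\<gamma>} + (\<Sum>(a, r)\<leftarrow>cs. F_cycle F r a)))"

inductive_set boolean_combinations :: "'a set set \<Rightarrow> 'a set set"
  for \<B> :: "'a set set"
  where
    base: "X \<in> \<B> \<Longrightarrow> X \<in> boolean_combinations \<B>"
  | compl: "X \<in> boolean_combinations \<B> \<Longrightarrow> - X \<in> boolean_combinations \<B>"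
  | union: "X \<in> boolean_combinations \<B> \<Longrightarrow> Y \<in> boolean_combinations \<B> \<Longrightarrow>
      X \<union> Y \<in> boolean_combinations \<B>"
  | inter: "X \<in> boolean_combinations \<B> \<Longrightarrow> Y \<in> boolean_combinations \<B> \<Longrightarrow>
      X \<inter> Y \<in> boolean_combinations \<B>"

end

theory Submission
  imports Defs
begin

text \<open>
  Let \<open>\<Phi> = F\<^sup>r\<close> be the endomorphism with the given spanning set. A nonzero element with few digits is
  not divisible by a high power of \<open>\<Phi>\<close>, up to the finite group \<open>core\<close> of infinitely divisible elements.
  Passing to a suitable power \<open>G\<close> of \<open>\<Phi>\<close> and to the image \<open>H\<close> of an averaging operator removes the core,
  so that an equation \<open>\<Sum> G\<^sup>e u = 0\<close> with \<open>u \<in> H\<close> splits wherever its exponents have a large gap.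

  Sparsity forces all loops of the same length at a useful state of the automaton to coincide. Hence
  \<open>A\<close> is a finite union of sets \<open>{\<gamma> + \<Sum> cyc (v i) (e i) | e 0 \<le> e 1 \<le> \<dots>}\<close>, where \<open>cyc v e\<close> is the partial
  sum \<open>v + G v + \<dots>\<close> with \<open>e\<close> terms. Allowing all exponents \<open>e\<close> instead gives a groupless
  \<open>F\<close>-set, a box. By the splitting of equations, whether a point of a given box lies in \<open>A\<close> depends, for
  widely spread exponents, only on the order of the exponents, and stability of \<open>A\<close> removes
  the dependence on the order. So \<open>A\<close> contains or misses all spread points of each box, and the
  remaining points lie in boxes of smaller dimension. This dichotomy passes to Boolean combinations
  with boxes, so that induction on the dimension finishes the proof.
\<close>

text \<open>Equations between points of boxes are handled by applying \<open>G - 1\<close>, which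
  turns a cycle into a difference of powers of \<open>G\<close>. Its kernel is \<open>core\<close>,
  so information would be lost if the core is nonzero; this is why all cycle coefficients are kept
  in \<open>H\<close>, where \<open>G - 1\<close> is injective. Constants may stay outside
  \<open>H\<close>, since they enter only through \<open>G \<gamma> - \<gamma>\<close>, which lies
  in \<open>H\<close> anyway. To get the coefficients of \<open>A\<close> into \<open>H\<close>,
  loop words are chosen as \<open>card core\<close> copies of a word of length \<open>p\<close>,
  with \<open>p\<close> a period of the core: the value of such a word is an average
  \<open>norm\<close>, and reading it shifts by exactly \<open>G\<close>. A piece constrains the
  order of its exponents, so at first the dichotomy is available only for a fixed order of far
  exponents. Stability is a hypothesis on the whole of \<open>A\<close> and not on its pieces; it is
  therefore applied to the union, and only afterwards is \<open>A\<close> cut by boxes.\<close>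

lemma additive_funpow:
  fixes f :: "'a::ab_group_add \<Rightarrow> 'a"
  assumes "additive f"
  shows "additive (f ^^ n)"
  using assms by (induction n) (auto simp: additive_def)

lemma funpow_commute_funpow: "(f ^^ m) ((f ^^ n) x) = (f ^^ n) ((f ^^ m) x)"
  by (metis add.commute comp_apply funpow_add)

section \<open>Values of concatenations and powers of words\<close>

lemma string_value_Nil [simp]: "string_value G [] = 0"
  by (simp add: string_value_def)

lemma string_value_Cons:
  assumes "additive G"
  shows "string_value G (s # \<sigma>) = s + G (string_value G \<sigma>)"
  by (simp add: string_value_def sum.lessThan_Suc_shift additive.sum[OF assms] del: sum.lessThan_Suc)

lemma string_value_append:
  assumes "additive G"
  shows "string_value G (\<sigma> @ \<tau>) = string_value G \<sigma> + (G ^^ length \<sigma>) (string_value G \<tau>)"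
  by (induction \<sigma>) (simp_all add: string_value_Cons[OF assms] additive.add[OF assms] add.assoc)

text \<open>Cycles originate here: pumping a loop produces a geometric sum.\<close>

lemma string_value_power:
  assumes "additive G"
  shows "string_value G (concat (replicate n z)) = (\<Sum>i<n. (G ^^ (length z * i)) (string_value G z))"
proof (induction n)
  case (Suc n)
  have "string_value G (concat (replicate (Suc n) z))
    = string_value G z + (\<Sum>i<n. (G ^^ length z) ((G ^^ (length z * i)) (string_value G z)))"
    by (simp add: string_value_append[OF assms] Suc additive.sum[OF additive_funpow[OF assms]])
  also have "\<dots> = (\<Sum>i<Suc n. (G ^^ (length z * i)) (string_value G z))"
    unfolding sum.lessThan_Suc_shift by (simp add: funpow_add)
  finally show ?case .
qed simp

section \<open>Divisibility in a group with a spanning set\<close>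

locale spanning =
  fixes \<Phi> :: "'a::ab_group_add \<Rightarrow> 'a" and S :: "'a set"
  assumes additive: "additive \<Phi>"
    and inj: "inj \<Phi>"
    and spanning: "spanning_set \<Phi> S"
begin

lemma pow_additive: "additive (\<Phi> ^^ n)"
  by (rule additive_funpow[OF additive])

lemmas pow_add = additive.add[OF pow_additive]
  and pow_diff = additive.diff[OF pow_additive]
  and pow_zero = additive.zero[OF pow_additive]
  and pow_sum = additive.sum[OF pow_additive]

lemma pow_inj: "inj (\<Phi> ^^ n)"
  by (induction n) (simp_all add: inj inj_compose del: comp_apply)

lemma pow_eq_iff [simp]: "(\<Phi> ^^ n) x = (\<Phi> ^^ n) y \<longleftrightarrow> x = y"
  using pow_inj by (auto simp: inj_def)

lemma finite_S: "finite S" and zero_S: "0 \<in> S"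
  using spanning by (auto simp: spanning_set_def)

lemma digit_sum:
  assumes "a \<in> S" "b \<in> S" "c \<in> S"
  shows "\<exists>s\<in>S. \<exists>t\<in>S. a + b + c = s + \<Phi> t"
proof -
  have "\<forall>a\<in>S. \<forall>b\<in>S. \<forall>c\<in>S. \<forall>d\<in>S. \<forall>e\<in>S. a + b + c + d + e \<in> S + \<Phi> ` S"
    using spanning unfolding spanning_set_def by (elim conjE) assumption
  from this[rule_format, OF assms zero_S zero_S] have "a + b + c \<in> S + \<Phi> ` S" by simp
  then show ?thesis by (auto elim!: set_plus_elim)
qed

lemma digit_divide:
  assumes "a \<in> S" "b \<in> S" "a + b \<in> range \<Phi>"
  shows "\<exists>s\<in>S. a + b = \<Phi> s"
proof -
  have "\<forall>a\<in>S. \<forall>b\<in>S. \<forall>c\<in>S. a + b + c \<in> range \<Phi> \<longrightarrow> a + b + c \<in> \<Phi> ` S"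
    using spanning unfolding spanning_set_def by (elim conjE) assumption
  from this[rule_format, OF assms(1,2) zero_S] have "a + b \<in> \<Phi> ` S" using assms(3) by simp
  then show ?thesis by blast
qed

text \<open>The values of digit strings of length \<open>l\<close>, lowest digit first. The index
  measures size, as opposed to divisibility by powers of \<open>\<Phi>\<close>.\<close>

primrec level :: "nat \<Rightarrow> 'a set"
  where "level 0 = {0}"
  | "level (Suc l) = {s + \<Phi> y | s y. s \<in> S \<and> y \<in> level l}"

lemma string_value_level: "\<sigma> \<in> lists S \<Longrightarrow> string_value \<Phi> \<sigma> \<in> level (length \<sigma>)"
proof (induction \<sigma>)
  case (Cons s \<sigma>)
  then have "s \<in> S" "string_value \<Phi> \<sigma> \<in> level (length \<sigma>)" by simp_all
  then show ?case unfolding string_value_Cons[OF additive] length_Cons level.simps by blast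
qed simp

lemma level_exists: "\<exists>l. a \<in> level l"
proof -
  have "\<forall>a. \<exists>\<sigma>\<in>lists S. a = string_value \<Phi> \<sigma>"
    using spanning unfolding spanning_set_def by (elim conjE) assumption
  then obtain \<sigma> where "\<sigma> \<in> lists S" "a = string_value \<Phi> \<sigma>" by metis
  then show ?thesis using string_value_level[of \<sigma>] by auto
qed

lemma zero_level: "0 \<in> level l"
proof (induction l)
  case (Suc l)
  have "0 = 0 + \<Phi> 0" by (simp add: additive.zero[OF additive])
  then show ?case using Suc zero_S unfolding level.simps by blast
qed simp

lemma level_Suc_mono: "x \<in> level l \<Longrightarrow> x \<in> level (Suc l)"
proof (induction l arbitrary: x)
  case 0
  then show ?case using zero_level[of "Suc 0"] by simp
next
  case (Suc l)
  then show ?case unfolding level.simps(2)[of "Suc l"] level.simps(2)[of l] by blast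
qed

lemma level_mono: "l \<le> l' \<Longrightarrow> x \<in> level l \<Longrightarrow> x \<in> level l'"
  by (induction l' rule: dec_induct) (auto dest: level_Suc_mono simp del: level.simps)

text \<open>Schoolbook addition, with \<open>s\<close> as incoming carry: by
  \<open>digit_sum\<close>, two digits and a carry leave one digit and a single carry for the next
  place.\<close>

lemma level_add_carry:
  "\<lbrakk>s \<in> S; x \<in> level l; y \<in> level l\<rbrakk> \<Longrightarrow> s + x + y \<in> level (Suc l)"
proof (induction l arbitrary: s x y)
  case 0
  have "s = s + \<Phi> 0" by (simp add: additive.zero[OF additive])
  then show ?case using 0 by auto
next
  case (Suc l)
  then obtain a x' b y' where x: "x = a + \<Phi> x'" "a \<in> S" "x' \<in> level l"
    and y: "y = b + \<Phi> y'" "b \<in> S" "y' \<in> level l"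
    by auto
  obtain c t where ct: "c \<in> S" "t \<in> S" "s + a + b = c + \<Phi> t"
    using digit_sum[OF Suc.prems(1) x(2) y(2)] by blast
  have "s + x + y = (s + a + b) + \<Phi> x' + \<Phi> y'"
    by (simp add: x(1) y(1) algebra_simps)
  also have "\<dots> = c + \<Phi> (t + x' + y')"
    unfolding ct(3) by (simp add: additive.add[OF additive] add.assoc)
  finally show ?case
    using ct(1) Suc.IH[OF ct(2) x(3) y(3)] level.simps(2)[of "Suc l"] by blast
qed

lemma level_add:
  assumes "x \<in> level l" "y \<in> level l"
  shows "x + y \<in> level (Suc l)"
  using level_add_carry[OF zero_S assms] by simp

text \<open>One new place per summand is a crude bound, but it depends only on the number of
  summands, which is all that \<open>gap\<close> requires.\<close>

lemma level_sum:
  assumes "finite X" "\<And>x. x \<in> X \<Longrightarrow> f x \<in> level l"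
  shows "sum f X \<in> level (l + card X)"
  using assms
proof (induction X)
  case (insert x X)
  have "f x \<in> level (l + card X)"
    using insert.prems level_mono[of l "l + card X"] by simp
  then show ?case using insert level_add by simp
qed (simp add: zero_level)

lemma level_pow: "x \<in> level l \<Longrightarrow> (\<Phi> ^^ j) x \<in> level (l + j)"
proof (induction j)
  case (Suc j)
  have "(\<Phi> ^^ Suc j) x = 0 + \<Phi> ((\<Phi> ^^ j) x)" by simp
  then show ?case using Suc zero_S level.simps(2) by force
qed simp

text \<open>Long division from the lowest place: divisibility of the sum forces \<open>s + a\<close>
  to be divisible by \<open>\<Phi>\<close>, and \<open>digit_divide\<close> makes the quotient a
  single digit, the carry into the next place. After \<open>l\<close> places only the carry
  remains.\<close>

lemma level_divide:
  "\<lbrakk>s \<in> S; x \<in> level l; s + x \<in> range (\<Phi> ^^ l)\<rbrakk> \<Longrightarrow> s + x \<in> (\<Phi> ^^ l) ` S"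
proof (induction l arbitrary: s x)
  case (Suc l)
  then obtain a y z where x: "x = a + \<Phi> y" "a \<in> S" "y \<in> level l"
    and z: "s + x = \<Phi> ((\<Phi> ^^ l) z)"
    by auto
  have "s + a = \<Phi> ((\<Phi> ^^ l) z - y)"
    using z x(1) by (simp add: additive.diff[OF additive] algebra_simps)
  then obtain t where t: "t \<in> S" "s + a = \<Phi> t"
    using digit_divide[OF Suc.prems(1) x(2)] by blast
  have sx: "s + x = \<Phi> (t + y)"
    using t(2) by (simp add: x(1) additive.add[OF additive] algebra_simps)
  then have "t + y = (\<Phi> ^^ l) z" using z inj by (auto simp: inj_def)
  then have "t + y \<in> (\<Phi> ^^ l) ` S" using Suc.IH[OF t(1) x(3)] by auto
  then show ?case using sx by auto
qed simp

lemma range_pow_antimono: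
  assumes "m \<le> n"
  shows "range (\<Phi> ^^ n) \<subseteq> range (\<Phi> ^^ m)"
proof -
  have "\<Phi> ^^ n = (\<Phi> ^^ m) \<circ> (\<Phi> ^^ (n - m))"
    using assms by (simp add: funpow_add[symmetric])
  then show ?thesis by auto
qed

section \<open>The subgroup of infinitely divisible elements\<close>

definition core :: "'a set"
  where "core = (\<Inter>n. range (\<Phi> ^^ n))"

lemma coreD: "x \<in> core \<Longrightarrow> \<exists>a. x = (\<Phi> ^^ n) a"
  unfolding core_def by blast

lemma coreI: "(\<And>n. \<exists>a. x = (\<Phi> ^^ n) a) \<Longrightarrow> x \<in> core"
  unfolding core_def by blast

lemma core_add:
  assumes "x \<in> core" "y \<in> core"
  shows "x + y \<in> core"
proof (rule coreI)
  fix n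
  obtain a b where "x = (\<Phi> ^^ n) a" "y = (\<Phi> ^^ n) b" using assms[THEN coreD] by metis
  then have "x + y = (\<Phi> ^^ n) (a + b)" by (simp only: pow_add)
  then show "\<exists>a. x + y = (\<Phi> ^^ n) a" ..
qed

lemma core_diff:
  assumes "x \<in> core" "y \<in> core"
  shows "x - y \<in> core"
proof (rule coreI)
  fix n
  obtain a b where "x = (\<Phi> ^^ n) a" "y = (\<Phi> ^^ n) b" using assms[THEN coreD] by metis
  then have "x - y = (\<Phi> ^^ n) (a - b)" by (simp only: pow_diff)
  then show "\<exists>a. x - y = (\<Phi> ^^ n) a" ..
qed

lemma core_pow:
  assumes "x \<in> core"
  shows "(\<Phi> ^^ l) x \<in> core"
proof (rule coreI)
  fix n
  obtain a where "x = (\<Phi> ^^ n) a" using coreD[OF assms] by blast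
  then have "(\<Phi> ^^ l) x = (\<Phi> ^^ n) ((\<Phi> ^^ l) a)" by (simp only: funpow_commute_funpow)
  then show "\<exists>a. (\<Phi> ^^ l) x = (\<Phi> ^^ n) a" ..
qed

lemma finite_subset_level: "finite U \<Longrightarrow> \<exists>l. U \<subseteq> level l"
proof (induction U rule: finite_induct)
  case (insert x U)
  then obtain l l' where "U \<subseteq> level l" "x \<in> level l'"
    using level_exists by metis
  then have "insert x U \<subseteq> level (max l l')"
    using level_mono[of l "max l l'"] level_mono[of l' "max l l'"] by auto
  then show ?case by blast
qed simp

text \<open>A finite part of the core has some common length \<open>l\<close>, so by
  \<open>level_divide\<close> it consists of images of digits under \<open>\<Phi> ^^ l\<close>. This
  gives the bound \<open>card S\<close>, whatever \<open>l\<close> is.\<close>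

lemma core_finite: "finite core"
proof (rule conjunct1[OF finite_if_finite_subsets_card_bdd])
  show "card Y \<le> card S" if Y: "Y \<subseteq> core" "finite Y" for Y
  proof -
    obtain l where l: "Y \<subseteq> level l" using Y finite_subset_level by blast
    have "y \<in> (\<Phi> ^^ l) ` S" if "y \<in> Y" for y
    proof -
      have "y \<in> range (\<Phi> ^^ l)" using that Y(1) coreD by blast
      then have "0 + y \<in> (\<Phi> ^^ l) ` S"
        using that l by (intro level_divide[OF zero_S]) auto
      then show ?thesis by simp
    qed
    then show "card Y \<le> card S" by (meson finite_S subsetI surj_card_le)
  qed
qed

lemma digits_eventually_core: "\<exists>j. S \<inter> range (\<Phi> ^^ j) \<subseteq> core"
proof -
  have "\<forall>s\<in>S - core. \<exists>j. s \<notin> range (\<Phi> ^^ j)" by (auto simp: core_def)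
  then obtain j where j: "\<And>s. s \<in> S - core \<Longrightarrow> s \<notin> range (\<Phi> ^^ j s)" by metis
  let ?m = "Max (insert 0 (j ` (S - core)))"
  have "s \<in> core" if "s \<in> S" "s \<in> range (\<Phi> ^^ ?m)" for s
  proof (rule ccontr)
    assume "s \<notin> core"
    then have "j s \<le> ?m" using that finite_S by (intro Max_ge) auto
    then show False using j[of s] that \<open>s \<notin> core\<close> range_pow_antimono by blast
  qed
  then show ?thesis by blast
qed

text \<open>Divisibility by \<open>\<Phi> ^^ l\<close> leaves a single digit, and the remaining
  \<open>j\<close> powers force that digit into the core. The excess \<open>j\<close> is the same
  for all \<open>l\<close>.\<close>

lemma divisible_core: "\<exists>j. \<forall>l x. x \<in> level l \<longrightarrow> x \<in> range (\<Phi> ^^ (l + j)) \<longrightarrow> x \<in> core"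
proof -
  obtain j where j: "S \<inter> range (\<Phi> ^^ j) \<subseteq> core" using digits_eventually_core by blast
  have "x \<in> core" if x: "x \<in> level l" "x \<in> range (\<Phi> ^^ (l + j))" for l x
  proof -
    obtain z where z: "x = (\<Phi> ^^ l) ((\<Phi> ^^ j) z)" using x(2) by (auto simp: funpow_add)
    then obtain s where s: "s \<in> S" "x = (\<Phi> ^^ l) s"
      using level_divide[OF zero_S x(1)] x(2) range_pow_antimono[of l "l + j"]
      by (metis add_0 imageE le_add1 subsetD)
    then have "s \<in> core" using z j by auto
    then show ?thesis using s core_pow by blast
  qed
  then show ?thesis by blast
qed

text \<open>In \<open>v = (\<Phi> ^^ q) v - ((\<Phi> ^^ q) v - v)\<close> the second term is
  divisible without limit and the first is more divisible than \<open>v\<close>, so each known power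
  of divisibility of \<open>v\<close> can be raised by one.\<close>

lemma core_cancel:
  assumes "q > 0" "(\<Phi> ^^ q) v - v \<in> core"
  shows "v \<in> core"
proof -
  have "v \<in> range (\<Phi> ^^ n)" for n
  proof (induction n)
    case (Suc n)
    then obtain z where z: "v = (\<Phi> ^^ n) z" by auto
    have "(\<Phi> ^^ q) v = (\<Phi> ^^ (n + q)) z" by (simp add: z funpow_add funpow_commute_funpow)
    moreover have "range (\<Phi> ^^ (n + q)) \<subseteq> range (\<Phi> ^^ Suc n)"
      using assms(1) by (intro range_pow_antimono) simp
    moreover have "(\<Phi> ^^ q) v - v \<in> range (\<Phi> ^^ Suc n)"
      using coreD[OF assms(2), of "Suc n"] by (metis rangeI)
    ultimately obtain a b
      where ab: "(\<Phi> ^^ q) v = (\<Phi> ^^ Suc n) a" "(\<Phi> ^^ q) v - v = (\<Phi> ^^ Suc n) b"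
      by blast
    have "v = (\<Phi> ^^ q) v - ((\<Phi> ^^ q) v - v)" by simp
    also have "\<dots> = (\<Phi> ^^ Suc n) a - (\<Phi> ^^ Suc n) b" by (simp only: ab(2)) (simp only: ab(1))
    finally have "v = (\<Phi> ^^ Suc n) (a - b)" by (simp only: pow_diff)
    then show ?case by blast
  qed simp
  then show ?thesis by (simp add: core_def)
qed

text \<open>An injective map of the finite core into itself has periodic orbits; the product of the
  individual periods serves all elements.\<close>

lemma core_period: "\<exists>p>0. \<forall>x\<in>core. (\<Phi> ^^ p) x = x"
proof -
  have "\<exists>p>0. (\<Phi> ^^ p) x = x" if "x \<in> core" for x
  proof -
    have "range (\<lambda>n. (\<Phi> ^^ n) x) \<subseteq> core" using core_pow[OF that] by auto
    then have "\<not> inj (\<lambda>n. (\<Phi> ^^ n) x)"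
      using finite_subset[OF _ core_finite] finite_imageD[of "\<lambda>n. (\<Phi> ^^ n) x" UNIV] by auto
    then obtain m n where mn: "m < n" "(\<Phi> ^^ m) x = (\<Phi> ^^ n) x"
      by (metis (mono_tags, lifting) injI linorder_neqE_nat)
    then have "(\<Phi> ^^ m) ((\<Phi> ^^ (n - m)) x) = (\<Phi> ^^ m) x"
      by (metis comp_apply funpow_add le_add_diff_inverse less_imp_le)
    then show ?thesis using mn(1) by (intro exI[of _ "n - m"]) simp
  qed
  then obtain p where p: "\<And>x. x \<in> core \<Longrightarrow> p x > 0 \<and> (\<Phi> ^^ p x) x = x" by metis
  have "(\<Phi> ^^ (prod p core)) x = x" if "x \<in> core" for x
  proof -
    have "p x dvd prod p core" using core_finite that by (rule dvd_prodI)
    then show ?thesis by (metis p[OF that] dvd_imp_mod_0 funpow_0 funpow_mod_eq)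
  qed
  moreover have "prod p core > 0" using p by (simp add: prod_pos)
  ultimately show ?thesis by blast
qed

text \<open>Translation by \<open>x\<close> permutes the core; comparing the sums over the core
  before and after leaves \<open>card core\<close> copies of \<open>x\<close>.\<close>

lemma core_torsion:
  assumes "x \<in> core"
  shows "(\<Sum>j<card core. x) = 0"
proof -
  have "(\<Sum>y\<in>core. y + x) = (\<Sum>y\<in>core. y)"
    by (rule sum.reindex_bij_witness[of _ "\<lambda>y. y - x" "\<lambda>y. y + x"])
      (use core_add core_diff assms in auto)
  then have "(\<Sum>y\<in>core. x) = 0" by (simp add: sum.distrib)
  moreover obtain h where "bij_betw h {..<card core} core"
    using ex_bij_betw_nat_finite[OF core_finite] by (auto simp: atLeast0LessThan)
  ultimately show ?thesis using sum.reindex_bij_betw[of h _ core "\<lambda>_. x"] by simp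
qed

end

section \<open>A power of the endomorphism and the averaged subgroup that avoids the core\<close>

locale spanning_period = spanning +
  fixes p :: nat
  assumes p_pos: "p > 0" and period: "x \<in> core \<Longrightarrow> (\<Phi> ^^ p) x = x"
begin

text \<open>\<open>p\<close> makes the powers in \<open>norm\<close> act trivially on the core, and
  \<open>card core\<close> copies of a core element sum to zero; their product is the shift for
  which \<open>norm\<close> telescopes.\<close>

definition M :: nat
  where "M = p * card core"

definition G :: "'a \<Rightarrow> 'a"
  where "G = \<Phi> ^^ M"

definition norm :: "'a \<Rightarrow> 'a"
  where "norm v = (\<Sum>j<card core. (\<Phi> ^^ (p * j)) v)"

definition H :: "'a set"
  where "H = range norm"

lemma core_zero: "0 \<in> core"
  by (rule coreI) (metis pow_zero)

lemma M_pos: "M > 0"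
  using p_pos core_zero core_finite by (auto simp: M_def card_gt_0_iff)

lemma norm_diff: "norm (v - w) = norm v - norm w"
  by (simp add: norm_def pow_diff sum_subtractf)

lemma H_norm: "norm v \<in> H"
  by (simp add: H_def)

lemma H_diff:
  assumes "v \<in> H" "w \<in> H"
  shows "v - w \<in> H"
proof -
  obtain a b where "v = norm a" "w = norm b" using assms unfolding H_def by blast
  then have "v - w = norm (a - b)" by (simp only: norm_diff)
  then show ?thesis by (simp only: H_norm)
qed

lemma H_zero: "0 \<in> H"
  using H_diff[OF H_norm[of 0] H_norm[of 0]] by simp

lemma H_minus: "v \<in> H \<Longrightarrow> - v \<in> H"
  using H_diff[OF H_zero, of v] by simp

lemma H_add: "v \<in> H \<Longrightarrow> w \<in> H \<Longrightarrow> v + w \<in> H"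
  using H_diff[OF _ H_minus, of v w] by simp

lemma H_sum: "(\<And>i. i \<in> I \<Longrightarrow> f i \<in> H) \<Longrightarrow> sum f I \<in> H"
  by (induction I rule: infinite_finite_induct) (simp_all add: H_zero H_add)

lemma H_pow:
  assumes "v \<in> H"
  shows "(\<Phi> ^^ n) v \<in> H"
proof -
  obtain w where w: "v = norm w" using assms unfolding H_def by blast
  have "(\<Phi> ^^ n) (norm w) = norm ((\<Phi> ^^ n) w)"
    by (simp only: norm_def pow_sum funpow_commute_funpow[of n])
  then show ?thesis by (simp only: w H_norm)
qed

lemma G_pow: "G ^^ n = \<Phi> ^^ (M * n)"
  by (simp add: G_def funpow_mult)

lemma H_G_pow: "v \<in> H \<Longrightarrow> (G ^^ n) v \<in> H"
  by (simp add: G_pow H_pow)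

lemma G_pow_add: "(G ^^ n) (v + w) = (G ^^ n) v + (G ^^ n) w"
  and G_pow_diff: "(G ^^ n) (v - w) = (G ^^ n) v - (G ^^ n) w"
  and G_pow_zero: "(G ^^ n) 0 = 0"
  and G_pow_sum: "(G ^^ n) (sum f I) = (\<Sum>i\<in>I. (G ^^ n) (f i))"
  by (simp_all add: G_pow pow_add pow_diff pow_zero pow_sum)

lemmas G_add = G_pow_add[of 1, simplified]
  and G_diff = G_pow_diff[of 1, simplified]
  and G_zero = G_pow_zero[of 1, simplified]
  and G_sum = G_pow_sum[of 1, simplified]

text \<open>This factorization of \<open>G - 1\<close> through \<open>norm\<close> puts the image of
  \<open>G - 1\<close> into \<open>H\<close>, and it drives the proof that \<open>H\<close> meets
  the core only in \<open>0\<close>.\<close>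

lemma norm_telescope: "norm ((\<Phi> ^^ p) v - v) = G v - v"
proof -
  have "(\<Phi> ^^ (p * j)) ((\<Phi> ^^ p) v - v) = (\<Phi> ^^ (p * Suc j)) v - (\<Phi> ^^ (p * j)) v" for j
    by (simp add: pow_diff funpow_add funpow_commute_funpow[of p])
  then have "norm ((\<Phi> ^^ p) v - v)
    = (\<Sum>j<card core. (\<Phi> ^^ (p * Suc j)) v - (\<Phi> ^^ (p * j)) v)"
    by (simp only: norm_def)
  also have "\<dots> = G v - v"
    using sum_lessThan_telescope[of "\<lambda>j. (\<Phi> ^^ (p * j)) v" "card core"] by (simp add: G_def M_def)
  finally show ?thesis .
qed

lemma G_minus_id_H: "G v - v \<in> H"
  unfolding norm_telescope[symmetric] by (rule H_norm)

text \<open>Averaging over a multiple of the period kills the core, since it is finite.\<close>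

lemma H_core:
  assumes "x \<in> H" "x \<in> core"
  shows "x = 0"
proof -
  obtain v where v: "x = norm v" using assms(1) unfolding H_def by blast
  have comm: "norm ((\<Phi> ^^ p) v) = (\<Phi> ^^ p) x"
    by (simp only: v norm_def pow_sum funpow_commute_funpow[of p])
  \<comment> \<open>Although only \<open>norm v\<close> is known to lie in the core, this difference
    lies there too, and \<open>core_cancel\<close> then brings in \<open>v\<close> itself.\<close>
  have "G v - v = norm ((\<Phi> ^^ p) v) - norm v"
    by (simp only: norm_telescope[symmetric] norm_diff)
  also have "\<dots> = (\<Phi> ^^ p) x - x" by (simp only: comm v[symmetric])
  finally have "(\<Phi> ^^ M) v - v \<in> core"
    unfolding G_def by (simp only: core_diff core_pow assms(2))
  then have "v \<in> core" by (rule core_cancel[OF M_pos])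
  have "(\<Phi> ^^ (p * j)) v = v" for j
  proof (induction j)
    case (Suc j)
    then show ?case by (simp only: mult_Suc_right funpow_add comp_apply period[OF \<open>v \<in> core\<close>])
  qed simp
  then show ?thesis unfolding v norm_def by (simp only: core_torsion[OF \<open>v \<in> core\<close>])
qed

text \<open>Injectivity of \<open>G - 1\<close> on \<open>H\<close>: an equation proved after
  applying \<open>G - 1\<close> can be taken back.\<close>

lemma G_fixed:
  assumes "x \<in> H" "G x - x = 0"
  shows "x = 0"
proof -
  have "x \<in> core" using core_cancel[OF M_pos, of x] assms(2) core_zero by (simp add: G_def)
  then show ?thesis using H_core assms(1) by blast
qed

section \<open>Cycle sums and short sums of powers\<close>

definition cyc :: "'a \<Rightarrow> nat \<Rightarrow> 'a"
  where "cyc v e = (\<Sum>i<e. (G ^^ i) v)"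

lemma cyc_0 [simp]: "cyc v 0 = 0"
  by (simp add: cyc_def)

lemma cyc_diff: "cyc (v - w) e = cyc v e - cyc w e"
  by (simp add: cyc_def G_pow_diff sum_subtractf)

lemma cyc_add: "cyc (v + w) e = cyc v e + cyc w e"
  by (simp add: cyc_def G_pow_add sum.distrib)

lemma cyc_H: "v \<in> H \<Longrightarrow> cyc v e \<in> H"
  by (simp add: cyc_def H_sum H_G_pow)

lemma G_cyc: "G (cyc v e) - cyc v e = (G ^^ e) v - v"
proof -
  have "G (cyc v e) - cyc v e = (\<Sum>i<e. (G ^^ Suc i) v - (G ^^ i) v)"
    by (simp add: cyc_def G_sum sum_subtractf)
  also have "\<dots> = (G ^^ e) v - v"
    using sum_lessThan_telescope[of "\<lambda>j. (G ^^ j) v" e] by simp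
  finally show ?thesis .
qed

text \<open>A power of \<open>G\<close> on an arbitrary constant becomes that constant plus a cycle
  with coefficient in \<open>H\<close>; so constants never have to be averaged.\<close>

lemma G_pow_eq_cyc: "(G ^^ e) w = w + cyc (G w - w) e"
proof -
  have "cyc (G w - w) e = (\<Sum>i<e. (G ^^ Suc i) w - (G ^^ i) w)"
    by (simp add: cyc_def G_pow_diff funpow_swap1)
  also have "\<dots> = (G ^^ e) w - w"
    using sum_lessThan_telescope[of "\<lambda>j. (G ^^ j) w" e] by simp
  finally show ?thesis by simp
qed

lemma cyc_shift: "cyc v (q + e) = cyc v q + (G ^^ q) (cyc v e)"
  by (induction e) (simp_all add: cyc_def G_pow_add G_pow_sum funpow_add add.assoc G_pow_zero)

lemma G_pow_cyc: "(G ^^ q) (cyc v e) = cyc ((G ^^ q) v) e"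
  by (simp add: cyc_def G_pow_sum funpow_commute_funpow[of q])

lemma range_G_pow_antimono: "m \<le> n \<Longrightarrow> range (G ^^ n) \<subseteq> range (G ^^ m)"
  by (simp add: G_pow range_pow_antimono)

lemma sum_range_G_pow:
  assumes "\<And>x. x \<in> X \<Longrightarrow> f x \<in> range (G ^^ n)"
  shows "sum f X \<in> range (G ^^ n)"
proof -
  have "\<forall>x\<in>X. \<exists>y. f x = (G ^^ n) y" using assms by blast
  then obtain g where "\<And>x. x \<in> X \<Longrightarrow> f x = (G ^^ n) (g x)" by metis
  then have "sum f X = (G ^^ n) (sum g X)" by (simp add: G_pow_sum)
  then show ?thesis by (metis rangeI)
qed

text \<open>The terms have length linear in \<open>t\<close>, so a sum divisible by a sufficiently
  higher power lies in the core by \<open>divisible_core\<close>. It also lies in \<open>H\<close>,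
  hence is zero. The constant \<open>C\<close> is uniform in the exponents and in the choice of
  coefficients from \<open>U\<close>.\<close>

lemma gap:
  assumes "finite U" "U \<subseteq> H"
  shows "\<exists>C>0. \<forall>(X::'x set) u \<epsilon> t. finite X \<longrightarrow> card X \<le> n \<longrightarrow> u ` X \<subseteq> U \<longrightarrow> (\<forall>x\<in>X. \<epsilon> x \<le> t) \<longrightarrow>
    (\<Sum>x\<in>X. (G ^^ \<epsilon> x) (u x)) \<in> range (G ^^ (t + C)) \<longrightarrow> (\<Sum>x\<in>X. (G ^^ \<epsilon> x) (u x)) = 0"
proof -
  obtain l where l: "U \<subseteq> level l" using finite_subset_level[OF assms(1)] by blast
  obtain j where j: "\<And>l x. x \<in> level l \<Longrightarrow> x \<in> range (\<Phi> ^^ (l + j)) \<Longrightarrow> x \<in> core"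
    using divisible_core by blast
  \<comment> \<open>\<open>l\<close> places for the coefficients, \<open>n\<close> for the carries
    of the sum, \<open>j\<close> for the excess in \<open>divisible_core\<close>, and
    \<open>1\<close> for positivity.\<close>
  let ?C = "l + n + j + 1"
  have "(\<Sum>x\<in>X. (G ^^ \<epsilon> x) (u x)) = 0"
    if X: "finite X" "card X \<le> n" "u ` X \<subseteq> U" "\<And>x. x \<in> X \<Longrightarrow> \<epsilon> x \<le> t"
      and range: "(\<Sum>x\<in>X. (G ^^ \<epsilon> x) (u x)) \<in> range (G ^^ (t + ?C))"
    for X :: "'x set" and u \<epsilon> t
  proof (rule H_core)
    let ?s = "\<Sum>x\<in>X. (G ^^ \<epsilon> x) (u x)"
    show "?s \<in> H" using X(3) assms(2) by (intro H_sum H_G_pow) blast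
    have "(G ^^ \<epsilon> x) (u x) \<in> level (l + M * t)" if "x \<in> X" for x
    proof (rule level_mono)
      show "l + M * \<epsilon> x \<le> l + M * t" using X(4)[OF that] by simp
      show "(G ^^ \<epsilon> x) (u x) \<in> level (l + M * \<epsilon> x)"
        unfolding G_pow using X(3) that l by (intro level_pow) blast
    qed
    then have "?s \<in> level (l + M * t + card X)" using X(1) by (intro level_sum)
    then have level: "?s \<in> level (l + M * t + n)" using X(2) by (intro level_mono[of _ "l + M * t + n"]) auto
    have "?C \<le> M * ?C" using M_pos by (cases M) auto
    then have "l + M * t + n + j \<le> M * (t + ?C)" by (simp add: distrib_left)
    then have "?s \<in> range (\<Phi> ^^ (l + M * t + n + j))"
      using range range_pow_antimono unfolding G_pow by blast
    then show "?s \<in> core" using j level by blast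
  qed
  then show ?thesis by (intro exI[of _ ?C] conjI allI impI) (simp, blast)
qed

end

section \<open>Vanishing sums of powers\<close>

definition spread :: "nat \<Rightarrow> ('x \<Rightarrow> nat) \<Rightarrow> 'x set \<Rightarrow> bool"
  where "spread K e I \<longleftrightarrow> (\<forall>i\<in>I. \<forall>j\<in>I. i \<noteq> j \<longrightarrow> e i + K \<le> e j \<or> e j + K \<le> e i)"

lemma spread_subset: "spread K e I \<Longrightarrow> J \<subseteq> I \<Longrightarrow> spread K e J"
  unfolding spread_def by blast

text \<open>Pigeonhole on \<open>n + 1\<close> consecutive windows of length \<open>C\<close> above
  \<open>a\<close>: an exponent strictly inside a window determines its number by division, so
  \<open>n\<close> exponents cannot block them all.\<close>

lemma exists_gap:
  fixes \<epsilon> :: "'x \<Rightarrow> nat"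
  assumes "finite X" "card X \<le> n" "C > 0"
  shows "\<exists>l\<le>n. \<forall>x\<in>X. \<epsilon> x \<le> a + l * C \<or> a + l * C + C \<le> \<epsilon> x"
proof (rule ccontr)
  assume neg: "\<not> ?thesis"
  have "l \<in> (\<lambda>x. (\<epsilon> x - a) div C) ` X" if l: "l \<le> n" for l
  proof -
    obtain x where x: "x \<in> X" "a + l * C < \<epsilon> x" "\<epsilon> x < a + l * C + C"
      using neg l by (meson not_le)
    then have "(\<epsilon> x - a) div C = l" by (intro div_nat_eqI) (simp_all add: algebra_simps)
    then show ?thesis using x(1) by blast
  qed
  then have "{..n} \<subseteq> (\<lambda>x. (\<epsilon> x - a) div C) ` X" by blast
  then have "card {..n} \<le> card X" using assms(1) by (rule surj_card_le[rotated])
  then show False using assms(2) by simp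
qed

context spanning_period
begin

text \<open>\<open>s\<close> names the mark in \<open>P\<close> to whose segment an index belongs.
  The last clause records the splitting of the equation as invariance: each segment may be moved by
  an amount of its own.\<close>

definition segmentation :: "('x \<Rightarrow> 'a) \<Rightarrow> ('x \<Rightarrow> nat) \<Rightarrow> 'x set \<Rightarrow> 'x set \<Rightarrow> ('x \<Rightarrow> 'x) \<Rightarrow> bool"
  where "segmentation u \<epsilon> X P s \<longleftrightarrow>
    (\<forall>x\<in>X. s x \<in> P) \<and> (\<forall>x\<in>P. s x = x) \<and>
    (\<forall>x\<in>X. \<forall>y\<in>X. \<epsilon> x \<le> \<epsilon> y \<longrightarrow> \<epsilon> (s x) \<le> \<epsilon> (s y)) \<and>
    (\<forall>d. (\<Sum>x\<in>X. (G ^^ (\<epsilon> x + d (s x))) (u x)) = 0)"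

lemma segmentation_singleton:
  assumes "(\<Sum>x\<in>X. (G ^^ \<epsilon> x) (u x)) = 0"
  shows "segmentation u \<epsilon> X {m} (\<lambda>_. m)"
proof -
  have "(\<Sum>x\<in>X. (G ^^ (\<epsilon> x + d)) (u x)) = (G ^^ d) (\<Sum>x\<in>X. (G ^^ \<epsilon> x) (u x))" for d
    unfolding G_pow_sum by (simp add: add.commute[of _ d] funpow_add)
  then show ?thesis by (simp add: segmentation_def assms G_pow_zero)
qed

text \<open>In a vanishing sum of powers of \<open>G\<close> with widely spread marked exponents, each stretch between
  consecutive marked exponents contains a large gap, and by \<open>gap\<close> the sum vanishes on either
  side of it.\<close>

lemma segments:
  assumes "finite U" "U \<subseteq> H"
  shows "\<exists>K>0. \<forall>(X::'x set) P u \<epsilon>. finite X \<longrightarrow> card X \<le> n \<longrightarrow> u ` X \<subseteq> U \<longrightarrow> P \<subseteq> X \<longrightarrow> P \<noteq> {} \<longrightarrow>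
    spread K \<epsilon> P \<longrightarrow> (\<Sum>x\<in>X. (G ^^ \<epsilon> x) (u x)) = 0 \<longrightarrow> (\<exists>s. segmentation u \<epsilon> X P s)"
proof -
  obtain C where C: "C > 0" and gap: "\<And>(X::'x set) u \<epsilon> t. \<lbrakk>finite X; card X \<le> n; u ` X \<subseteq> U;
      \<forall>x\<in>X. \<epsilon> x \<le> t; (\<Sum>x\<in>X. (G ^^ \<epsilon> x) (u x)) \<in> range (G ^^ (t + C))\<rbrakk>
      \<Longrightarrow> (\<Sum>x\<in>X. (G ^^ \<epsilon> x) (u x)) = 0"
    using gap[OF assms, of n, where 'x = 'x] by blast
  \<comment> \<open>Room for the \<open>n + 1\<close> windows of \<open>exists_gap\<close> between
    two marks.\<close>
  let ?K = "(n + 1) * C"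
  have "\<exists>s. segmentation u \<epsilon> X P s"
    if "finite X" "card X \<le> n" "u ` X \<subseteq> U" "P \<subseteq> X" "P \<noteq> {}" "spread ?K \<epsilon> P"
      "(\<Sum>x\<in>X. (G ^^ \<epsilon> x) (u x)) = 0" for X P :: "'x set" and u \<epsilon>
    using that
  proof (induction "card P" arbitrary: X P rule: less_induct)
    case less
    have finP: "finite P" using less.prems finite_subset by blast
    have "Max (\<epsilon> ` P) \<in> \<epsilon> ` P" using finP less.prems(5) by (intro Max_in) simp_all
    then obtain p where p: "p \<in> P" "\<epsilon> p = Max (\<epsilon> ` P)" by (metis imageE)
    then have p_max: "\<epsilon> x \<le> \<epsilon> p" if "x \<in> P" for x using finP that by simp
    show ?case
    proof (cases "P = {p}")
      case True
      then show ?thesis using segmentation_singleton[OF less.prems(7)] by blast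
    next
      case False
      define P' where "P' = P - {p}"
      have P': "P' \<noteq> {}" "finite P'" using False p(1) finP by (auto simp: P'_def)
      have "Max (\<epsilon> ` P') \<in> \<epsilon> ` P'" using P' by (intro Max_in) simp_all
      then obtain q where q: "q \<in> P'" "\<epsilon> q = Max (\<epsilon> ` P')" by (metis imageE)
      then have q_max: "\<epsilon> x \<le> \<epsilon> q" if "x \<in> P'" for x using P'(2) that by simp
      have "?K > 0" using C by simp
      moreover have "q \<in> P" "q \<noteq> p" using q(1) by (simp_all add: P'_def)
      ultimately have qp: "\<epsilon> q + ?K \<le> \<epsilon> p"
        using less.prems(6) p(1) p_max[of q] unfolding spread_def by fastforce
      obtain l where l: "l \<le> n" "\<And>x. x \<in> X \<Longrightarrow> \<epsilon> x \<le> \<epsilon> q + l * C \<or> \<epsilon> q + l * C + C \<le> \<epsilon> x"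
        using exists_gap[OF less.prems(1,2) C] by metis
      define t where "t = \<epsilon> q + l * C"
      have "l * C \<le> n * C" "?K = n * C + C" using l(1) by simp_all
      then have "t + C \<le> \<epsilon> p" using qp unfolding t_def by linarith
      define Y where "Y = {x \<in> X. \<epsilon> x \<le> t}"
      have Y: "Y \<subseteq> X" "finite Y" "card Y \<le> n"
        using less.prems(1,2) card_mono[of X Y] by (auto simp: Y_def)
      have Y_above: "t + C \<le> \<epsilon> x" if "x \<in> X - Y" for x
        using l(2)[of x] that by (auto simp: Y_def t_def)
      have split: "sum f X = sum f Y + sum f (X - Y)" for f :: "'x \<Rightarrow> 'a"
        using sum.subset_diff[OF Y(1) less.prems(1), of f] by (simp add: add.commute)
      have "(\<Sum>x\<in>X - Y. (G ^^ \<epsilon> x) (u x)) \<in> range (G ^^ (t + C))"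
        using Y_above range_G_pow_antimono by (intro sum_range_G_pow) blast
      then obtain z where "(\<Sum>x\<in>X - Y. (G ^^ \<epsilon> x) (u x)) = (G ^^ (t + C)) z" by (metis imageE)
      then have "(\<Sum>x\<in>Y. (G ^^ \<epsilon> x) (u x)) + (G ^^ (t + C)) z = 0"
        using less.prems(7) split by simp
      then have "(\<Sum>x\<in>Y. (G ^^ \<epsilon> x) (u x)) = (G ^^ (t + C)) (0 - z)"
        unfolding G_pow_diff G_pow_zero by (simp add: eq_neg_iff_add_eq_0)
      then have "(\<Sum>x\<in>Y. (G ^^ \<epsilon> x) (u x)) \<in> range (G ^^ (t + C))" by (metis rangeI)
      \<comment> \<open>The part below the gap is minus the part above it, hence divisible by
        \<open>G ^^ (t + C)\<close> although its own exponents are at most \<open>t\<close>.\<close>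
      then have sumY: "(\<Sum>x\<in>Y. (G ^^ \<epsilon> x) (u x)) = 0"
        using Y less.prems(3) by (intro gap[of Y u]) (auto simp: Y_def)
      then have sumXY: "(\<Sum>x\<in>X - Y. (G ^^ \<epsilon> x) (u x)) = 0"
        using less.prems(7) split by simp
      have "P' \<subseteq> Y"
      proof
        fix x assume x: "x \<in> P'"
        then have "\<epsilon> x \<le> t" using q_max by (simp add: t_def trans_le_add1)
        then show "x \<in> Y" using x less.prems(4) by (auto simp: P'_def Y_def)
      qed
      moreover have "card P' < card P"
        unfolding P'_def using finP p(1) by (rule card_Diff1_less)
      moreover have "u ` Y \<subseteq> U" using less.prems(3) Y(1) by blast
      moreover have "spread ?K \<epsilon> P'" using less.prems(6) spread_subset[of _ _ P P'] by (auto simp: P'_def)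
      ultimately obtain s where s: "segmentation u \<epsilon> Y P' s"
        using less.hyps[of P' Y] Y P'(1) sumY by blast
      have "p \<notin> Y" using \<open>t + C \<le> \<epsilon> p\<close> C by (simp add: Y_def)
      \<comment> \<open>The only mark above the gap is \<open>p\<close>, so everything there moves
        with \<open>p\<close>; below, the induction hypothesis has already assigned the
        marks.\<close>
      define r where "r x = (if x \<in> Y then s x else p)" for x
      have "segmentation u \<epsilon> X P r"
        unfolding segmentation_def
      proof (intro conjI ballI impI allI)
        fix x assume "x \<in> X"
        then show "r x \<in> P" using s p(1) by (auto simp: r_def segmentation_def P'_def)
      next
        fix x assume "x \<in> P"
        then show "r x = x"
          using s \<open>p \<notin> Y\<close> \<open>P' \<subseteq> Y\<close> by (cases "x = p") (auto simp: r_def segmentation_def P'_def)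
      next
        fix x y assume xy: "x \<in> X" "y \<in> X" "\<epsilon> x \<le> \<epsilon> y"
        show "\<epsilon> (r x) \<le> \<epsilon> (r y)"
        proof (cases "y \<in> Y")
          case True
          then have "x \<in> Y" using xy by (simp add: Y_def)
          then show ?thesis using True s xy(3) by (simp add: r_def segmentation_def)
        next
          case False
          have "s x \<in> P" if "x \<in> Y" using s that by (auto simp: segmentation_def P'_def)
          then show ?thesis using False p_max by (simp add: r_def)
        qed
      next
        fix d
        have "(\<Sum>x\<in>Y. (G ^^ (\<epsilon> x + d (r x))) (u x)) = (\<Sum>x\<in>Y. (G ^^ (\<epsilon> x + d (s x))) (u x))"
          by (rule sum.cong) (simp_all add: r_def)
        also have "\<dots> = 0" using s unfolding segmentation_def by blast
        finally have 1: "(\<Sum>x\<in>Y. (G ^^ (\<epsilon> x + d (r x))) (u x)) = 0" .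
        have "(\<Sum>x\<in>X - Y. (G ^^ (\<epsilon> x + d (r x))) (u x)) = (\<Sum>x\<in>X - Y. (G ^^ (\<epsilon> x + d p)) (u x))"
          by (rule sum.cong) (simp_all add: r_def)
        also have "\<dots> = 0"
          using segmentation_singleton[OF sumXY, of p] unfolding segmentation_def by blast
        finally show "(\<Sum>x\<in>X. (G ^^ (\<epsilon> x + d (r x))) (u x)) = 0" using 1 split by simp
      qed
      then show ?thesis by blast
    qed
  qed
  then show ?thesis using C by (intro exI[of _ ?K] conjI allI impI) (simp, blast)
qed

end

text \<open>The lower bound keeps the exponents away from \<open>0\<close>, the exponent of the
  constant term, so that \<open>0\<close> can be added as a further mark.\<close>

definition far :: "nat \<Rightarrow> ('x \<Rightarrow> nat) \<Rightarrow> 'x set \<Rightarrow> bool"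
  where "far K e I \<longleftrightarrow> (\<forall>i\<in>I. K \<le> e i) \<and> spread K e I"

lemma far_mono: "far K e I \<Longrightarrow> K' \<le> K \<Longrightarrow> far K' e I"
  unfolding far_def spread_def by (meson add_left_mono le_trans)

section \<open>Two representations of one point\<close>

context spanning_period
begin

definition val :: "'a \<Rightarrow> 'x set \<Rightarrow> ('x \<Rightarrow> 'a) \<Rightarrow> ('x \<Rightarrow> nat) \<Rightarrow> 'a"
  where "val \<gamma> I v e = \<gamma> + (\<Sum>i\<in>I. cyc (v i) (e i))"

lemma val_cong: "(\<And>i. i \<in> I \<Longrightarrow> e i = e' i) \<Longrightarrow> val \<gamma> I v e = val \<gamma> I v e'"
  by (simp add: val_def)

text \<open>Under \<open>G - 1\<close> each cycle contributes one moving power and one constant, so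
  equations between points become sums of powers as in \<open>segments\<close>.\<close>

lemma G_minus_id_val:
  "G (val \<gamma> I v e) - val \<gamma> I v e = G \<gamma> - \<gamma> + (\<Sum>i\<in>I. (G ^^ e i) (v i)) - sum v I"
proof -
  have "G (val \<gamma> I v e) - val \<gamma> I v e = G \<gamma> - \<gamma> + (\<Sum>i\<in>I. G (cyc (v i) (e i)) - cyc (v i) (e i))"
    by (simp add: val_def G_add G_sum sum_subtractf algebra_simps)
  then show ?thesis by (simp only: G_cyc) (simp add: sum_subtractf algebra_simps)
qed

lemma G_minus_id_val_diff:
  "G (val \<gamma> I v e - val \<gamma>' J w e') - (val \<gamma> I v e - val \<gamma>' J w e')
    = (G (\<gamma> - \<gamma>') - (\<gamma> - \<gamma>') - sum v I + sum w J)
      + (\<Sum>i\<in>I. (G ^^ e i) (v i)) - (\<Sum>j\<in>J. (G ^^ e' j) (w j))"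
proof -
  have "G (val \<gamma> I v e - val \<gamma>' J w e') - (val \<gamma> I v e - val \<gamma>' J w e')
    = (G (val \<gamma> I v e) - val \<gamma> I v e) - (G (val \<gamma>' J w e') - val \<gamma>' J w e')"
    by (simp add: G_diff)
  then show ?thesis by (simp add: G_minus_id_val G_diff algebra_simps)
qed

lemma val_diff_H:
  assumes "v ` I \<subseteq> H"
  shows "val \<gamma> I v e - val \<gamma> I v e' \<in> H"
proof -
  have "val \<gamma> I v e - val \<gamma> I v e' = (\<Sum>i\<in>I. cyc (v i) (e i)) - (\<Sum>i\<in>I. cyc (v i) (e' i))"
    by (simp add: val_def)
  then show ?thesis using assms by (simp add: H_diff H_sum cyc_H image_subset_iff)
qed

text \<open>The exponents \<open>e\<close> together with an origin \<open>None\<close> at exponent \<open>0\<close> cut the exponents \<open>e'\<close> into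
  segments \<open>s\<close>, and each segment may be moved along with its exponent.\<close>

lemma transfer:
  fixes I :: "'x set" and J :: "'y set"
  assumes fin: "finite I" "finite J" and H: "v ` I \<subseteq> H" "w ` J \<subseteq> H"
  shows "\<exists>K>0. \<forall>e e'. far K e I \<longrightarrow> val \<gamma> I v e = val \<gamma>' J w e' \<longrightarrow>
    (\<exists>s. (\<forall>j\<in>J. s j \<in> insert None (Some ` I)) \<and>
      (\<forall>j\<in>J. \<forall>l\<in>J. e' j \<le> e' l \<longrightarrow> case_option 0 e (s j) \<le> case_option 0 e (s l)) \<and>
      (\<forall>d. val \<gamma> I v (\<lambda>i. e i + d i) = val \<gamma>' J w (\<lambda>j. e' j + case_option 0 d (s j))))"
proof -
  \<comment> \<open>The constant left by applying \<open>G - 1\<close> to the difference of the two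
    points. It is the coefficient at the origin.\<close>
  define \<kappa> where "\<kappa> = G (\<gamma> - \<gamma>') - (\<gamma> - \<gamma>') - sum v I + sum w J"
  define O' where "O' = insert None (Some ` I)"
  define X where "X = O' <+> J"
  define u where "u = case_sum (case_option \<kappa> v) (\<lambda>j. - w j)"
  have finO: "finite O'" using fin by (simp add: O'_def)
  have sum_O: "sum f O' = f None + (\<Sum>i\<in>I. f (Some i))" for f :: "'x option \<Rightarrow> 'a"
    unfolding O'_def using fin(1) by (simp add: sum.reindex)
  have sum_X: "sum f X = f (Inl None) + (\<Sum>i\<in>I. f (Inl (Some i))) + (\<Sum>j\<in>J. f (Inr j))"
    for f :: "'x option + 'y \<Rightarrow> 'a"
    unfolding X_def using fin(2) finO by (simp add: sum.Plus sum_O)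
  have "finite X" unfolding X_def using fin(2) finO by simp
  have "\<kappa> \<in> H" unfolding \<kappa>_def using H by (intro H_add H_diff G_minus_id_H H_sum) auto
  then have "u ` X \<subseteq> H" using H H_minus by (auto simp: u_def X_def O'_def)
  have "\<exists>K>0. \<forall>(X'::('x option + 'y) set) P u' \<epsilon>. finite X' \<longrightarrow> card X' \<le> card X \<longrightarrow>
      u' ` X' \<subseteq> u ` X \<longrightarrow> P \<subseteq> X' \<longrightarrow> P \<noteq> {} \<longrightarrow> spread K \<epsilon> P \<longrightarrow>
      (\<Sum>x\<in>X'. (G ^^ \<epsilon> x) (u' x)) = 0 \<longrightarrow> (\<exists>s. segmentation u' \<epsilon> X' P s)"
    by (rule segments) (simp_all add: \<open>finite X\<close> \<open>u ` X \<subseteq> H\<close>)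
  then obtain K where "K > 0" and K: "\<forall>(X'::('x option + 'y) set) P u' \<epsilon>. finite X' \<longrightarrow>
      card X' \<le> card X \<longrightarrow> u' ` X' \<subseteq> u ` X \<longrightarrow> P \<subseteq> X' \<longrightarrow> P \<noteq> {} \<longrightarrow> spread K \<epsilon> P \<longrightarrow>
      (\<Sum>x\<in>X'. (G ^^ \<epsilon> x) (u' x)) = 0 \<longrightarrow> (\<exists>s. segmentation u' \<epsilon> X' P s)"
    by (elim exE conjE) assumption
  show ?thesis
  proof (intro exI[of _ K] conjI \<open>K > 0\<close> allI impI)
    fix e e' assume e: "far K e I" and eq: "val \<gamma> I v e = val \<gamma>' J w e'"
    define \<epsilon> where "\<epsilon> = case_sum (case_option 0 e) e'"
    have "spread K \<epsilon> (Inl ` O')"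
      using e by (auto simp: spread_def far_def \<epsilon>_def O'_def)
    moreover have "(\<Sum>x\<in>X. (G ^^ \<epsilon> x) (u x)) = 0"
    proof -
      have "(\<Sum>x\<in>X. (G ^^ \<epsilon> x) (u x))
        = \<kappa> + (\<Sum>i\<in>I. (G ^^ e i) (v i)) - (\<Sum>j\<in>J. (G ^^ e' j) (w j))"
        using G_pow_diff[of _ 0] by (simp add: sum_X u_def \<epsilon>_def sum_negf G_pow_zero)
      also have "\<dots> = 0"
        using G_minus_id_val_diff[of \<gamma> I v e \<gamma>' J w e'] by (simp add: eq G_zero \<kappa>_def)
      finally show ?thesis .
    qed
    ultimately obtain r where r: "segmentation u \<epsilon> X (Inl ` O') r"
      using K[rule_format, OF \<open>finite X\<close> order_refl order_refl, of "Inl ` O'" \<epsilon>]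
      by (auto simp: X_def O'_def)
    define s where "s j = projl (r (Inr j))" for j
    have rs: "s j \<in> O' \<and> r (Inr j) = Inl (s j)" if "j \<in> J" for j
    proof -
      have "r (Inr j) \<in> Inl ` O'" using r that unfolding segmentation_def X_def by blast
      then show ?thesis by (auto simp: s_def)
    qed
    have r_fix: "r (Inl x) = Inl x" if "x \<in> O'" for x
      using r that unfolding segmentation_def by blast
    show "\<exists>s. (\<forall>j\<in>J. s j \<in> insert None (Some ` I)) \<and>
      (\<forall>j\<in>J. \<forall>l\<in>J. e' j \<le> e' l \<longrightarrow> case_option 0 e (s j) \<le> case_option 0 e (s l)) \<and>
      (\<forall>d. val \<gamma> I v (\<lambda>i. e i + d i) = val \<gamma>' J w (\<lambda>j. e' j + case_option 0 d (s j)))"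
    proof (intro exI[of _ s] conjI ballI allI impI)
      fix j assume "j \<in> J"
      then show "s j \<in> insert None (Some ` I)" using rs by (simp add: O'_def)
    next
      fix j l assume jl: "j \<in> J" "l \<in> J" "e' j \<le> e' l"
      have "\<forall>x\<in>X. \<forall>y\<in>X. \<epsilon> x \<le> \<epsilon> y \<longrightarrow> \<epsilon> (r x) \<le> \<epsilon> (r y)"
        using r unfolding segmentation_def by (elim conjE)
      moreover have "Inr j \<in> X" "Inr l \<in> X" "\<epsilon> (Inr j) \<le> \<epsilon> (Inr l)"
        using jl by (simp_all add: X_def \<epsilon>_def InrI)
      ultimately have "\<epsilon> (r (Inr j)) \<le> \<epsilon> (r (Inr l))" by blast
      then show "case_option 0 e (s j) \<le> case_option 0 e (s l)"
        using rs jl(1,2) by (simp add: \<epsilon>_def)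
    next
      fix d :: "'x \<Rightarrow> nat"
      \<comment> \<open>The origin is not moved, so its constant \<open>\<kappa>\<close> and every
        exponent in its segment stay in place.\<close>
      define d' where "d' = case_sum (case_option 0 d) (\<lambda>_::'y. 0)"
      let ?e = "\<lambda>i. e i + d i" and ?e' = "\<lambda>j. e' j + case_option 0 d (s j)"
      let ?\<delta> = "val \<gamma> I v ?e - val \<gamma>' J w ?e'"
      have "\<forall>d. (\<Sum>x\<in>X. (G ^^ (\<epsilon> x + d (r x))) (u x)) = 0"
        using r unfolding segmentation_def by (elim conjE)
      then have "0 = (\<Sum>x\<in>X. (G ^^ (\<epsilon> x + d' (r x))) (u x))" by metis
      also have "\<dots> = \<kappa> + (\<Sum>i\<in>I. (G ^^ ?e i) (v i)) + (\<Sum>j\<in>J. (G ^^ ?e' j) (- w j))"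
        unfolding sum_X
      proof (intro arg_cong2[of _ _ _ _ "(+)"] sum.cong refl)
        show "(G ^^ (\<epsilon> (Inl None) + d' (r (Inl None)))) (u (Inl None)) = \<kappa>"
          by (simp add: r_fix O'_def \<epsilon>_def u_def d'_def)
        show "(G ^^ (\<epsilon> (Inl (Some i)) + d' (r (Inl (Some i))))) (u (Inl (Some i))) = (G ^^ ?e i) (v i)"
          if "i \<in> I" for i
          using that by (simp add: r_fix O'_def \<epsilon>_def u_def d'_def)
        show "(G ^^ (\<epsilon> (Inr j) + d' (r (Inr j)))) (u (Inr j)) = (G ^^ ?e' j) (- w j)"
          if "j \<in> J" for j
          using rs[OF that] by (simp add: \<epsilon>_def u_def d'_def)
      qed
      also have "\<dots> = \<kappa> + (\<Sum>i\<in>I. (G ^^ ?e i) (v i)) - (\<Sum>j\<in>J. (G ^^ ?e' j) (w j))"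
        using G_pow_diff[of _ 0] by (simp add: sum_negf G_pow_zero)
      also have "\<dots> = G ?\<delta> - ?\<delta>"
        unfolding \<kappa>_def by (rule G_minus_id_val_diff[symmetric])
      finally have "G ?\<delta> - ?\<delta> = 0" by simp
      \<comment> \<open>The constants \<open>\<gamma>\<close> and \<open>\<gamma>'\<close> need not
        lie in \<open>H\<close>; they cancel against the equation for the original
        exponents.\<close>
      moreover have "?\<delta> \<in> H"
      proof -
        have "(val \<gamma> I v ?e - val \<gamma> I v e) - (val \<gamma>' J w ?e' - val \<gamma>' J w e') \<in> H"
          by (intro H_diff val_diff_H H)
        then show ?thesis using eq by simp
      qed
      ultimately have "?\<delta> = 0" using G_fixed by blast
      then show "val \<gamma> I v ?e = val \<gamma>' J w ?e'" by simp
    qed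
  qed
qed

end

section \<open>Genericity and stability\<close>

definition chain :: "nat \<Rightarrow> ('x \<Rightarrow> nat) \<Rightarrow> 'x list \<Rightarrow> bool"
  where "chain K e xs \<longleftrightarrow> (\<forall>i\<in>set xs. K \<le> e i) \<and> sorted_wrt (\<lambda>i j. e i + K \<le> e j) xs"

lemma chain_mono:
  assumes "chain K e xs" "K' \<le> K"
  shows "chain K' e xs"
proof -
  have "sorted_wrt (\<lambda>i j. e i + K' \<le> e j) xs"
    by (rule sorted_wrt_mono_rel[of _ "\<lambda>i j. e i + K \<le> e j"]) (use assms in \<open>auto simp: chain_def\<close>)
  then show ?thesis using assms by (auto simp: chain_def)
qed

text \<open>Positions in \<open>xs\<close> decide which exponent is larger, so one chain determines
  the comparison for all chains along \<open>xs\<close> and all gaps.\<close>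

lemma chain_cases:
  assumes "i \<in> set xs" "j \<in> set xs" "i \<noteq> j"
  shows "(\<forall>K e. chain K e xs \<longrightarrow> e i + K \<le> e j) \<or> (\<forall>K e. chain K e xs \<longrightarrow> e j + K \<le> e i)"
proof -
  obtain a b where ab: "a < length xs" "b < length xs" "i = xs ! a" "j = xs ! b"
    using assms by (metis in_set_conv_nth)
  then have "a < b \<or> b < a" using assms(3) by (metis linorder_neqE_nat)
  then show ?thesis using ab unfolding chain_def sorted_wrt_iff_nth_less by blast
qed

lemma chain_imp_far: "chain K e xs \<Longrightarrow> far K e (set xs)"
  using chain_cases unfolding far_def spread_def by (metis chain_def)

lemma far_imp_chain:
  assumes "finite I" "far K e I"
  shows "\<exists>xs. distinct xs \<and> set xs = I \<and> chain K e xs"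
proof -
  obtain ys where ys: "set ys = I" "distinct ys" using finite_distinct_list[OF assms(1)] by blast
  define xs where "xs = sort_key e ys"
  have xs: "distinct xs" "set xs = I" "sorted (map e xs)" using ys by (simp_all add: xs_def)
  have "e (xs ! a) + K \<le> e (xs ! b)" if "a < b" "b < length xs" for a b
  proof -
    have "e (xs ! a) \<le> e (xs ! b)" using xs(3) that by (simp add: sorted_iff_nth_mono_less)
    moreover have "xs ! a \<noteq> xs ! b" using xs(1) that by (simp add: nth_eq_iff_index_eq)
    moreover have "xs ! a \<in> I" "xs ! b \<in> I" using xs(2) that nth_mem by auto
    ultimately show ?thesis using assms(2) unfolding far_def spread_def by fastforce
  qed
  then have "chain K e xs"
    using assms(2) xs(2) by (simp add: chain_def sorted_wrt_iff_nth_less far_def)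
  then show ?thesis using xs by blast
qed

text \<open>Sorting puts far exponents into one of finitely many orders; the largest of the finitely
  many thresholds works for all.\<close>

lemma far_if_chains:
  assumes "finite I"
    and "\<And>xs. distinct xs \<Longrightarrow> set xs = I \<Longrightarrow> \<exists>K. \<forall>e. chain K e xs \<longrightarrow> Q e"
  shows "\<exists>K. \<forall>e. far K e I \<longrightarrow> Q e"
proof -
  let ?L = "{xs. set xs \<subseteq> I \<and> length xs = card I}"
  obtain K where K: "\<And>xs e. \<lbrakk>distinct xs; set xs = I; chain (K xs) e xs\<rbrakk> \<Longrightarrow> Q e"
    using assms(2) by metis
  have fin: "finite ?L" using assms(1) by (rule finite_lists_length_eq)
  have "Q e" if far: "far (Max (K ` ?L)) e I" for e
  proof -
    obtain xs where xs: "distinct xs" "set xs = I" "chain (Max (K ` ?L)) e xs"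
      using far_imp_chain[OF assms(1) far] by blast
    then have "xs \<in> ?L" using distinct_card by force
    then have "K xs \<le> Max (K ` ?L)" using fin by (intro Max_ge) simp_all
    then show ?thesis using K xs chain_mono by blast
  qed
  then show ?thesis by blast
qed

text \<open>The offset \<open>L\<close> makes the induction go through and later places a whole
  block above given exponents.\<close>

lemma exists_chain:
  fixes K L :: nat
  assumes "distinct xs"
  shows "\<exists>e. (\<forall>c\<in>set xs. L + K \<le> e c) \<and> sorted_wrt (\<lambda>i j. e i + K \<le> e j) xs"
  using assms
proof (induction xs arbitrary: L)
  case (Cons x xs)
  have x: "distinct xs" "x \<notin> set xs" using Cons.prems by simp_all
  obtain e where e: "\<forall>c\<in>set xs. L + K + K \<le> e c" "sorted_wrt (\<lambda>i j. e i + K \<le> e j) xs"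
    using Cons.IH[OF x(1), of "L + K"] by blast
  define e' where "e' = e(x := L + K)"
  have e': "e' x = L + K" "\<And>c. c \<in> set xs \<Longrightarrow> e' c = e c" using x(2) by (auto simp: e'_def)
  have "sorted_wrt (\<lambda>i j. e' i + K \<le> e' j) xs"
    by (rule sorted_wrt_mono_rel[OF _ e(2)]) (simp add: e'(2))
  moreover have "L + K \<le> e' c" "L + K + K \<le> e' c" if "c \<in> set xs" for c
    using e(1) that add_leD1[of "L + K" K "e c"] by (simp_all add: e'(2))
  ultimately have "(\<forall>c\<in>set (x # xs). L + K \<le> e' c) \<and> sorted_wrt (\<lambda>i j. e' i + K \<le> e' j) (x # xs)"
    using e'(1) by simp
  then show ?case by blast
qed simp

text \<open>\<open>x\<close> moves left past one neighbour at a time. Fixing the multiset confines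
  the swap hypothesis to rearrangements of one list.\<close>

lemma adjacent_swaps_front:
  assumes swap: "\<And>xs a b ys. mset (xs @ a # b # ys) = M \<Longrightarrow> P (xs @ a # b # ys) \<Longrightarrow> P (xs @ b # a # ys)"
  shows "mset (pre @ xs @ x # ys) = M \<Longrightarrow> P (pre @ xs @ x # ys) \<Longrightarrow> P (pre @ x # xs @ ys)"
proof (induction xs arbitrary: ys rule: rev_induct)
  case (snoc z xs)
  have "P ((pre @ xs) @ x # z # ys)"
    by (rule swap) (use snoc.prems in simp_all)
  then show ?case using snoc.IH[of "z # ys"] snoc.prems(1) by (simp add: add_mset_commute)
qed simp

text \<open>Adjacent transpositions generate all permutations: the head of the target list is
  brought forward and then joins the fixed prefix.\<close>

lemma adjacent_swaps:
  assumes swap: "\<And>xs a b ys. mset (xs @ a # b # ys) = M \<Longrightarrow> P (xs @ a # b # ys) \<Longrightarrow> P (xs @ b # a # ys)"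
  shows "\<lbrakk>mset (pre @ xs) = M; mset xs = mset ys; P (pre @ xs)\<rbrakk> \<Longrightarrow> P (pre @ ys)"
proof (induction ys arbitrary: pre xs)
  case (Cons y ys)
  have "y \<in> set xs" using Cons.prems(2) by (metis list.set_intros(1) set_mset_mset)
  then obtain xs1 xs2 where xs: "xs = xs1 @ y # xs2" by (metis split_list)
  have "P (pre @ y # xs1 @ xs2)"
    by (rule adjacent_swaps_front[where P = P and M = M, OF swap]) (use Cons.prems xs in simp_all)
  then show ?case
    using Cons.IH[of "pre @ [y]" "xs1 @ xs2"] Cons.prems(1,2) xs by simp
qed simp

section \<open>Boxes, pieces and the dichotomy for far exponents\<close>

context spanning_period
begin

definition box :: "'a \<Rightarrow> nat set \<Rightarrow> (nat \<Rightarrow> 'a) \<Rightarrow> 'a set"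
  where "box \<gamma> I v = {val \<gamma> I v e | e. True}"

definition piece :: "'a \<Rightarrow> nat \<Rightarrow> (nat \<Rightarrow> 'a) \<Rightarrow> 'a set"
  where "piece \<gamma> k v = {val \<gamma> {..<k} v e | e. \<forall>i j. i \<le> j \<longrightarrow> j < k \<longrightarrow> e i \<le> e j}"

text \<open>All boxes are tested, not just those that cover \<open>A\<close>; this makes the
  property stable under Boolean operations.\<close>

definition generic :: "'a set \<Rightarrow> bool"
  where "generic A \<longleftrightarrow> (\<forall>\<gamma> I v. finite I \<longrightarrow> v ` I \<subseteq> H \<longrightarrow>
    (\<exists>K. (\<forall>e::nat \<Rightarrow> nat. far K e I \<longrightarrow> val \<gamma> I v e \<in> A) \<or> (\<forall>e. far K e I \<longrightarrow> val \<gamma> I v e \<notin> A)))"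

definition ordered_generic :: "'a set \<Rightarrow> bool"
  where "ordered_generic A \<longleftrightarrow> (\<forall>\<gamma> xs v. distinct xs \<longrightarrow> v ` set xs \<subseteq> H \<longrightarrow>
    (\<exists>K. (\<forall>e::nat \<Rightarrow> nat. chain K e xs \<longrightarrow> val \<gamma> (set xs) v e \<in> A) \<or>
      (\<forall>e. chain K e xs \<longrightarrow> val \<gamma> (set xs) v e \<notin> A)))"

lemma generic_Compl: "generic A \<Longrightarrow> generic (- A)"
  unfolding generic_def Compl_iff by meson

lemma generic_Un:
  assumes "generic A" "generic B"
  shows "generic (A \<union> B)"
  unfolding generic_def
proof (intro allI impI)
  fix \<gamma> I and v :: "nat \<Rightarrow> 'a" assume I: "finite I" "v ` I \<subseteq> H"
  obtain K where K: "(\<forall>e. far K e I \<longrightarrow> val \<gamma> I v e \<in> A) \<or> (\<forall>e. far K e I \<longrightarrow> val \<gamma> I v e \<notin> A)"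
    using assms(1) I unfolding generic_def by meson
  obtain L where L: "(\<forall>e. far L e I \<longrightarrow> val \<gamma> I v e \<in> B) \<or> (\<forall>e. far L e I \<longrightarrow> val \<gamma> I v e \<notin> B)"
    using assms(2) I unfolding generic_def by meson
  have "far K e I" "far L e I" if "far (max K L) e I" for e :: "nat \<Rightarrow> nat"
    using far_mono[OF that] by simp_all
  then show "\<exists>K. (\<forall>e. far K e I \<longrightarrow> val \<gamma> I v e \<in> A \<union> B) \<or> (\<forall>e. far K e I \<longrightarrow> val \<gamma> I v e \<notin> A \<union> B)"
    using K L by (intro exI[of _ "max K L"]) (metis Un_iff)
qed

lemma generic_Int: "generic A \<Longrightarrow> generic B \<Longrightarrow> generic (A \<inter> B)"
  using generic_Compl[OF generic_Un[OF generic_Compl generic_Compl], of A B] by simp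

lemma ordered_generic_empty: "ordered_generic {}"
  unfolding ordered_generic_def by simp

lemma ordered_generic_Un:
  assumes "ordered_generic A" "ordered_generic B"
  shows "ordered_generic (A \<union> B)"
  unfolding ordered_generic_def
proof (intro allI impI)
  fix \<gamma> xs and v :: "nat \<Rightarrow> 'a" assume xs: "distinct xs" "v ` set xs \<subseteq> H"
  let ?f = "val \<gamma> (set xs) v"
  obtain K where K: "(\<forall>e. chain K e xs \<longrightarrow> ?f e \<in> A) \<or> (\<forall>e. chain K e xs \<longrightarrow> ?f e \<notin> A)"
    using assms(1) xs unfolding ordered_generic_def by meson
  obtain L where L: "(\<forall>e. chain L e xs \<longrightarrow> ?f e \<in> B) \<or> (\<forall>e. chain L e xs \<longrightarrow> ?f e \<notin> B)"
    using assms(2) xs unfolding ordered_generic_def by meson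
  have "chain K e xs" "chain L e xs" if "chain (max K L) e xs" for e :: "nat \<Rightarrow> nat"
    using chain_mono[OF that] by simp_all
  then show "\<exists>K. (\<forall>e. chain K e xs \<longrightarrow> ?f e \<in> A \<union> B) \<or> (\<forall>e. chain K e xs \<longrightarrow> ?f e \<notin> A \<union> B)"
    using K L by (intro exI[of _ "max K L"]) (metis Un_iff)
qed

lemma ordered_generic_Union:
  "finite \<A> \<Longrightarrow> (\<And>A. A \<in> \<A> \<Longrightarrow> ordered_generic A) \<Longrightarrow> ordered_generic (\<Union>\<A>)"
  by (induction \<A> rule: finite_induct) (simp_all add: ordered_generic_empty ordered_generic_Un)

text \<open>One far point in common suffices: \<open>transfer\<close> turns every coordinatewise
  increase of its exponents into a change of exponents in the other box.\<close>

lemma box_generic: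
  assumes J: "finite J" "w ` J \<subseteq> H"
  shows "generic (box \<gamma>' J w)"
  unfolding generic_def
proof (intro allI impI)
  fix \<gamma> I and v :: "nat \<Rightarrow> 'a" assume I: "finite I" "v ` I \<subseteq> H"
  obtain K where K: "\<And>e e'. far K e I \<Longrightarrow> val \<gamma> I v e = val \<gamma>' J w e' \<Longrightarrow>
      \<exists>s. \<forall>d. val \<gamma> I v (\<lambda>i. e i + d i) = val \<gamma>' J w (\<lambda>j. e' j + case_option 0 d (s j))"
    using transfer[OF I(1) J(1) I(2) J(2), of \<gamma> \<gamma>'] by meson
  show "\<exists>K. (\<forall>e. far K e I \<longrightarrow> val \<gamma> I v e \<in> box \<gamma>' J w) \<or> (\<forall>e. far K e I \<longrightarrow> val \<gamma> I v e \<notin> box \<gamma>' J w)"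
  proof (cases "\<exists>e. far K e I \<and> val \<gamma> I v e \<in> box \<gamma>' J w")
    case True
    then obtain e0 e' where e0: "far K e0 I" "val \<gamma> I v e0 = val \<gamma>' J w e'"
      unfolding box_def by blast
    then obtain s where s: "\<And>d. val \<gamma> I v (\<lambda>i. e0 i + d i) = val \<gamma>' J w (\<lambda>j. e' j + case_option 0 d (s j))"
      using K by meson
    \<comment> \<open>The sum dominates every \<open>e0 i\<close>, so \<open>e\<close> arises from
      \<open>e0\<close> by a nonnegative shift.\<close>
    have "val \<gamma> I v e \<in> box \<gamma>' J w" if far: "far (sum e0 I) e I" for e
    proof -
      have "e0 i \<le> e i" if "i \<in> I" for i
        using far that member_le_sum[of i I e0] I(1) unfolding far_def by fastforce
      then have "val \<gamma> I v e = val \<gamma> I v (\<lambda>i. e0 i + (e i - e0 i))" by (intro val_cong) simp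
      also have "\<dots> = val \<gamma>' J w (\<lambda>j. e' j + case_option 0 (\<lambda>i. e i - e0 i) (s j))" by (rule s)
      finally show ?thesis unfolding box_def by blast
    qed
    then show ?thesis by blast
  qed blast
qed

text \<open>As for boxes, except that the transferred exponents must again be monotone. Segments are
  met in increasing order, so it is enough that the shifts increase along the marks, which holds
  when the order of the exponents is fixed.\<close>

lemma piece_ordered_generic:
  assumes w: "w ` {..<k} \<subseteq> H"
  shows "ordered_generic (piece \<gamma>' k w)"
  unfolding ordered_generic_def
proof (intro allI impI)
  fix \<gamma> xs and v :: "nat \<Rightarrow> 'a" assume xs: "distinct xs" "v ` set xs \<subseteq> H"
  let ?f = "val \<gamma> (set xs) v"
  obtain K where "K > 0" and K: "\<forall>e e'. far K e (set xs) \<longrightarrow> ?f e = val \<gamma>' {..<k} w e' \<longrightarrow>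
    (\<exists>s. (\<forall>j\<in>{..<k}. s j \<in> insert None (Some ` set xs)) \<and>
      (\<forall>j\<in>{..<k}. \<forall>l\<in>{..<k}. e' j \<le> e' l \<longrightarrow> case_option 0 e (s j) \<le> case_option 0 e (s l)) \<and>
      (\<forall>d. ?f (\<lambda>i. e i + d i) = val \<gamma>' {..<k} w (\<lambda>j. e' j + case_option 0 d (s j))))"
    using transfer[OF finite_set finite_lessThan xs(2) w, of \<gamma> \<gamma>'] by (elim exE conjE) (rule that)
  show "\<exists>K. (\<forall>e. chain K e xs \<longrightarrow> ?f e \<in> piece \<gamma>' k w) \<or> (\<forall>e. chain K e xs \<longrightarrow> ?f e \<notin> piece \<gamma>' k w)"
  proof (cases "\<exists>e. chain K e xs \<and> ?f e \<in> piece \<gamma>' k w")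
    case True
    then obtain e0 e' where e0: "chain K e0 xs" "?f e0 = val \<gamma>' {..<k} w e'"
      and e': "\<And>i j. i \<le> j \<Longrightarrow> j < k \<Longrightarrow> e' i \<le> e' j"
      unfolding piece_def by blast
    obtain s where s_in: "\<forall>j\<in>{..<k}. s j \<in> insert None (Some ` set xs)"
      and s_mono: "\<forall>j\<in>{..<k}. \<forall>l\<in>{..<k}. e' j \<le> e' l \<longrightarrow> case_option 0 e0 (s j) \<le> case_option 0 e0 (s l)"
      and shift: "\<forall>d. ?f (\<lambda>i. e0 i + d i) = val \<gamma>' {..<k} w (\<lambda>j. e' j + case_option 0 d (s j))"
      using K[rule_format, OF chain_imp_far[OF e0(1)] e0(2)] by (elim exE conjE) (rule that)
    let ?K = "sum e0 (set xs)"
    have e0_le: "e0 i \<le> ?K" if "i \<in> set xs" for i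
      using that by (intro member_le_sum) simp_all
    have "?f e \<in> piece \<gamma>' k w" if e: "chain ?K e xs" for e
    proof -
      define d where "d i = e i - e0 i" for i
      have e0_le_e: "e0 i \<le> e i" if "i \<in> set xs" for i
        using e e0_le[OF that] that unfolding chain_def by (meson le_trans)
      \<comment> \<open>Along the chain \<open>e\<close> the gaps are at least the sum of
        \<open>e0\<close>, so subtracting \<open>e0\<close> cannot reverse the order.\<close>
      have d_mono: "d i \<le> d i'" if i: "i \<in> set xs" "i' \<in> set xs" "e0 i \<le> e0 i'" for i i'
      proof (cases "i = i'")
        case False
        have "\<not> e0 i' + K \<le> e0 i" using i(3) \<open>K > 0\<close> by simp
        then have "\<forall>K e. chain K e xs \<longrightarrow> e i + K \<le> e i'"
          using chain_cases[OF i(1,2) False] e0(1) by blast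
        then have "e i + ?K \<le> e i'" using e by blast
        then show ?thesis using e0_le[OF i(2)] unfolding d_def by linarith
      qed simp
      have "?f e = ?f (\<lambda>i. e0 i + d i)"
        using e0_le_e by (intro val_cong) (simp add: d_def)
      also have "\<dots> = val \<gamma>' {..<k} w (\<lambda>j. e' j + case_option 0 d (s j))" by (rule shift[rule_format])
      finally have eq: "?f e = val \<gamma>' {..<k} w (\<lambda>j. e' j + case_option 0 d (s j))" .
      have "e' j + case_option 0 d (s j) \<le> e' l + case_option 0 d (s l)" if jl: "j \<le> l" "l < k" for j l
      proof -
        have le: "case_option 0 e0 (s j) \<le> case_option 0 e0 (s l)"
          using jl e' by (intro s_mono[rule_format]) simp_all
        \<comment> \<open>The origin has shift \<open>0\<close>. A segment at a mark cannot be
          followed by that of the origin, because marks have positive exponents.\<close>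
        have "case_option 0 d (s j) \<le> case_option 0 d (s l)"
        proof (cases "s j")
          case (Some i)
          then have i: "i \<in> set xs" using s_in[rule_format, of j] jl by auto
          then have "0 < e0 i" using e0(1) \<open>K > 0\<close> unfolding chain_def by (meson less_le_trans)
          then obtain i' where i': "s l = Some i'" using le Some by (cases "s l") simp_all
          then have "i' \<in> set xs" using s_in[rule_format, of l] jl by auto
          then show ?thesis using d_mono[OF i] le Some i' by simp
        qed simp
        then show ?thesis using e'[OF jl] by (rule add_mono[rotated])
      qed
      then show ?thesis unfolding piece_def eq by blast
    qed
    then show ?thesis by blast
  qed blast
qed


lemma ordered_genericD:
  assumes "ordered_generic A" "distinct xs" "v ` set xs \<subseteq> H"
  shows "\<exists>K. (\<forall>e::nat \<Rightarrow> nat. chain K e xs \<longrightarrow> val \<gamma> (set xs) v e \<in> A) \<or>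
    (\<forall>e. chain K e xs \<longrightarrow> val \<gamma> (set xs) v e \<notin> A)"
  by (rule assms(1)[unfolded ordered_generic_def, THEN spec, THEN spec, THEN spec, THEN mp, THEN mp])
    (rule assms)+

text \<open>If exchanging two neighbours in the order of the exponents led out of \<open>A\<close>, then interleaving
  many values of these two exponents would produce the order relation in \<open>A\<close>.\<close>

lemma stable_swap:
  fixes xs ys :: "nat list" and v :: "nat \<Rightarrow> 'a"
  assumes A: "ordered_generic A" "stable_set A"
    and dist: "distinct (xs @ a # b # ys)" and H: "v ` set (xs @ a # b # ys) \<subseteq> H"
    and holds: "\<exists>K. \<forall>e. chain K e (xs @ a # b # ys) \<longrightarrow> val \<gamma> (set (xs @ a # b # ys)) v e \<in> A"
  shows "\<exists>K. \<forall>e. chain K e (xs @ b # a # ys) \<longrightarrow> val \<gamma> (set (xs @ b # a # ys)) v e \<in> A"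
proof (rule ccontr)
  assume neg: "\<not> ?thesis"
  let ?I = "set (xs @ a # b # ys)"
  have I: "set (xs @ b # a # ys) = ?I" by auto
  obtain K1 where K1: "\<And>e. chain K1 e (xs @ a # b # ys) \<Longrightarrow> val \<gamma> ?I v e \<in> A"
    using holds by blast
  have "distinct (xs @ b # a # ys)" "v ` set (xs @ b # a # ys) \<subseteq> H" using dist H by auto
  then have "\<exists>K. (\<forall>e. chain K e (xs @ b # a # ys) \<longrightarrow> val \<gamma> (set (xs @ b # a # ys)) v e \<in> A) \<or>
      (\<forall>e. chain K e (xs @ b # a # ys) \<longrightarrow> val \<gamma> (set (xs @ b # a # ys)) v e \<notin> A)"
    by (rule ordered_genericD[OF A(1)])
  then obtain K2 where K2: "\<And>e. chain K2 e (xs @ b # a # ys) \<Longrightarrow> val \<gamma> ?I v e \<notin> A"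
    using neg unfolding I by blast
  define K where "K = max K1 K2"
  obtain N :: nat where N: "\<not> (\<exists>a b :: nat \<Rightarrow> 'a. \<forall>i\<in>{1..N}. \<forall>j\<in>{1..N}. a i + b j \<in> A \<longleftrightarrow> i \<le> j)"
    using A(2) unfolding stable_set_def by blast
  have d: "distinct xs" "distinct ys" "a \<notin> set xs" "a \<notin> set ys" "b \<notin> set xs" "b \<notin> set ys" "a \<noteq> b"
    "set xs \<inter> set ys = {}"
    using dist by auto
  obtain e1 where e1: "\<forall>c\<in>set xs. 0 + K \<le> e1 c" "sorted_wrt (\<lambda>i j. e1 i + K \<le> e1 j) xs"
    using exists_chain[OF d(1)] by blast
  define B where "B = sum e1 (set xs)"
  have B: "e1 c \<le> B" if "c \<in> set xs" for c
    unfolding B_def using that by (intro member_le_sum) simp_all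
  \<comment> \<open>The block \<open>ys\<close> starts above \<open>B + (2 * N + 1) * K\<close>, the
    largest value that the two moving exponents will take.\<close>
  obtain e2 where e2: "\<forall>c\<in>set ys. (B + (2 * N + 1) * K) + K \<le> e2 c"
    "sorted_wrt (\<lambda>i j. e2 i + K \<le> e2 j) ys"
    using exists_chain[OF d(2)] by blast
  define e0 where "e0 c = (if c \<in> set xs then e1 c else e2 c)" for c
  \<comment> \<open>Even and odd multiples of \<open>K\<close> interleave: \<open>X i\<close> lies
    below \<open>Y j\<close> exactly when \<open>i \<le> j\<close>, and always with a gap of at
    least \<open>K\<close>.\<close>
  define X where "X i = B + 2 * i * K" for i
  define Y where "Y j = B + (2 * j + 1) * K" for j
  define e where "e i j = e0(a := X i, b := Y j)" for i j
  have e_simps: "e i j a = X i" "e i j b = Y j" "\<And>c. c \<in> set xs \<Longrightarrow> e i j c = e1 c"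
    "\<And>c. c \<in> set ys \<Longrightarrow> e i j c = e2 c" for i j
    using d by (auto simp: e_def e0_def)
  have sorted: "sorted_wrt (\<lambda>c c'. e i j c + K \<le> e i j c') xs"
    "sorted_wrt (\<lambda>c c'. e i j c + K \<le> e i j c') ys" for i j
    by (rule sorted_wrt_mono_rel[OF _ e1(2)], simp add: e_simps,
      rule sorted_wrt_mono_rel[OF _ e2(2)], simp add: e_simps)
  have bounds: "B + K \<le> X i" "B + K \<le> Y j" "X i + K \<le> B + (2 * N + 1) * K + K"
    "Y j + K \<le> B + (2 * N + 1) * K + K"
    if ij: "i \<in> {1..N}" "j \<in> {1..N}" for i j
  proof -
    have "1 * K \<le> 2 * i * K" "1 * K \<le> (2 * j + 1) * K" "2 * i * K \<le> (2 * N + 1) * K"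
      "(2 * j + 1) * K \<le> (2 * N + 1) * K"
      using ij by (intro mult_le_mono1; simp)+
    then show "B + K \<le> X i" "B + K \<le> Y j" "X i + K \<le> B + (2 * N + 1) * K + K"
      "Y j + K \<le> B + (2 * N + 1) * K + K"
      unfolding X_def Y_def by linarith+
  qed
  have lo: "K \<le> e1 c" "e1 c \<le> B" if "c \<in> set xs" for c using e1(1) B that by auto
  have hi: "B + (2 * N + 1) * K + K \<le> e2 c" if "c \<in> set ys" for c using e2(1) that by blast
  have chain_iff: "chain K (e i j) (xs @ a # b # ys)" if ij: "i \<in> {1..N}" "j \<in> {1..N}" "i \<le> j" for i j
  proof -
    have "2 * i * K \<le> 2 * j * K" using ij(3) by simp
    then have "X i + K \<le> Y j" by (simp add: X_def Y_def)
    moreover have "X i + K \<le> e2 c" "Y j + K \<le> e2 c" "K \<le> e2 c" if "c \<in> set ys" for c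
      using hi[OF that] bounds[OF ij(1,2)] by linarith+
    moreover have "e1 c + K \<le> X i" "e1 c + K \<le> Y j" if "c \<in> set xs" for c
      using lo[OF that] bounds[OF ij(1,2)] by linarith+
    moreover have "e1 c + K \<le> e2 c'" if "c \<in> set xs" "c' \<in> set ys" for c c'
      using lo[OF that(1)] hi[OF that(2)] by linarith
    moreover have "K \<le> X i" "K \<le> Y j" using bounds[OF ij(1,2)] by linarith+
    ultimately show ?thesis
      using lo sorted by (auto simp: chain_def sorted_wrt_append e_simps)
  qed
  have chain_swap: "chain K (e i j) (xs @ b # a # ys)" if ij: "i \<in> {1..N}" "j \<in> {1..N}" "j < i" for i j
  proof -
    have "(2 * j + 2) * K \<le> 2 * i * K" using ij(3) by (intro mult_le_mono1) simp
    then have "Y j + K \<le> X i" by (simp add: X_def Y_def)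
    moreover have "X i + K \<le> e2 c" "Y j + K \<le> e2 c" "K \<le> e2 c" if "c \<in> set ys" for c
      using hi[OF that] bounds[OF ij(1,2)] by linarith+
    moreover have "e1 c + K \<le> X i" "e1 c + K \<le> Y j" if "c \<in> set xs" for c
      using lo[OF that] bounds[OF ij(1,2)] by linarith+
    moreover have "e1 c + K \<le> e2 c'" if "c \<in> set xs" "c' \<in> set ys" for c c'
      using lo[OF that(1)] hi[OF that(2)] by linarith
    moreover have "K \<le> X i" "K \<le> Y j" using bounds[OF ij(1,2)] by linarith+
    ultimately show ?thesis
      using lo sorted by (auto simp: chain_def sorted_wrt_append e_simps)
  qed
  \<comment> \<open>Only the \<open>a\<close>-term depends on \<open>i\<close>; the remaining terms
    go into \<open>\<beta>\<close>, so that the point is a sum as in the definition of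
    stability.\<close>
  define \<alpha> where "\<alpha> i = cyc (v a) (X i)" for i
  define \<beta> where "\<beta> j = \<gamma> + cyc (v b) (Y j) + (\<Sum>c\<in>set xs \<union> set ys. cyc (v c) (e0 c))" for j
  have "\<alpha> i + \<beta> j = val \<gamma> ?I v (e i j)" for i j
  proof -
    have "?I = insert a (insert b (set xs \<union> set ys))" by auto
    moreover have "(\<Sum>c\<in>set xs \<union> set ys. cyc (v c) (e0 c)) = (\<Sum>c\<in>set xs \<union> set ys. cyc (v c) (e i j c))"
      by (rule sum.cong) (use d in \<open>auto simp: e_def\<close>)
    ultimately show ?thesis
      using d by (simp add: val_def \<alpha>_def \<beta>_def e_simps algebra_simps)
  qed
  moreover have "val \<gamma> ?I v (e i j) \<in> A \<longleftrightarrow> i \<le> j" if ij: "i \<in> {1..N}" "j \<in> {1..N}" for i j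
  proof (cases "i \<le> j")
    case True
    then have "chain K1 (e i j) (xs @ a # b # ys)"
      using chain_mono[OF chain_iff[OF ij True]] by (simp add: K_def)
    then show ?thesis using K1 True by blast
  next
    case False
    then have "chain K2 (e i j) (xs @ b # a # ys)"
      using chain_mono[OF chain_swap[OF ij]] by (simp add: K_def)
    then show ?thesis using K2 False by blast
  qed
  ultimately have "\<forall>i\<in>{1..N}. \<forall>j\<in>{1..N}. \<alpha> i + \<beta> j \<in> A \<longleftrightarrow> i \<le> j" by simp
  then show False using N by blast
qed

text \<open>By \<open>stable_swap\<close>, membership for one order of the exponents spreads to all
  orders; if no order gives membership, each one gives exclusion. \<open>far_if_chains\<close>
  merges the orders in both cases.\<close>

lemma stable_imp_generic:
  assumes A: "ordered_generic A" "stable_set A"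
  shows "generic A"
  unfolding generic_def
proof (intro allI impI)
  fix \<gamma> I and v :: "nat \<Rightarrow> 'a" assume I: "finite I" "v ` I \<subseteq> H"
  define P where "P xs \<longleftrightarrow> (\<exists>K. \<forall>e. chain K e xs \<longrightarrow> val \<gamma> (set xs) v e \<in> A)" for xs
  have P_perm: "P ys" if xs: "distinct xs" "set xs = I" and ys: "distinct ys" "set ys = I" and P: "P xs"
    for xs ys
  proof -
    have "P (zs @ b # a # ws)" if zs: "mset (zs @ a # b # ws) = mset xs" "P (zs @ a # b # ws)"
      for zs a b ws
    proof -
      have "distinct (zs @ a # b # ws)" "set (zs @ a # b # ws) = I"
        using mset_eq_imp_distinct_iff[OF zs(1)] mset_eq_setD[OF zs(1)] xs by simp_all
      then show ?thesis
        using stable_swap[OF A, of zs a b ws v \<gamma>] I(2) zs(2) unfolding P_def by metis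
    qed
    moreover have "mset xs = mset ys" using xs ys by (metis set_eq_iff_mset_eq_distinct)
    ultimately show ?thesis using adjacent_swaps[of "mset xs" P "[]" xs ys] P by simp
  qed
  show "\<exists>K. (\<forall>e. far K e I \<longrightarrow> val \<gamma> I v e \<in> A) \<or> (\<forall>e. far K e I \<longrightarrow> val \<gamma> I v e \<notin> A)"
  proof (cases "\<exists>xs. distinct xs \<and> set xs = I \<and> P xs")
    case True
    then have "\<exists>K. \<forall>e. chain K e ys \<longrightarrow> val \<gamma> I v e \<in> A" if "distinct ys" "set ys = I" for ys
      using P_perm[of _ ys] that unfolding P_def by metis
    then show ?thesis using far_if_chains[OF I(1), of "\<lambda>e. val \<gamma> I v e \<in> A"] by blast
  next
    case False
    have "\<exists>K. \<forall>e. chain K e ys \<longrightarrow> val \<gamma> I v e \<notin> A" if ys: "distinct ys" "set ys = I" for ys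
    proof -
      have "v ` set ys \<subseteq> H" using ys(2) I(2) by simp
      moreover have "\<not> P ys" using False ys by blast
      ultimately show ?thesis using A(1) ys unfolding ordered_generic_def P_def by metis
    qed
    then show ?thesis using far_if_chains[OF I(1), of "\<lambda>e. val \<gamma> I v e \<notin> A"] by blast
  qed
qed

end

section \<open>Boolean combinations of boxes\<close>

lemma groupless_singleton: "groupless_F_set F {\<gamma>}"
proof -
  have "(\<forall>(a, r)\<in>set []. r > 0) \<and> {\<gamma>} = {\<gamma>} + (\<Sum>(a, r)\<leftarrow>[]. F_cycle F r a)" by simp
  then have "\<exists>\<gamma>' cs. (\<forall>(a, r)\<in>set cs. r > 0) \<and> {\<gamma>} = {\<gamma>'} + (\<Sum>(a, r)\<leftarrow>cs. F_cycle F r a)" by (intro exI)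
  then have "finite {{\<gamma>}} \<and> {\<gamma>} = \<Union>{{\<gamma>}} \<and> (\<forall>B\<in>{{\<gamma>}}. \<exists>\<gamma>' cs. (\<forall>(a, r)\<in>set cs. r > 0) \<and>
      B = {\<gamma>'} + (\<Sum>(a, r)\<leftarrow>cs. F_cycle F r a))"
    by simp
  then show ?thesis unfolding groupless_F_set_def by (rule exI)
qed

lemma groupless_Un:
  assumes "groupless_F_set F A" "groupless_F_set F B"
  shows "groupless_F_set F (A \<union> B)"
proof -
  let ?P = "\<lambda>B. \<exists>\<gamma> cs. (\<forall>(a, r)\<in>set cs. r > 0) \<and> B = {\<gamma>} + (\<Sum>(a, r)\<leftarrow>cs. F_cycle F r a)"
  obtain \<A> where "finite \<A>" "A = \<Union>\<A>" "\<forall>B\<in>\<A>. ?P B"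
    using assms(1) unfolding groupless_F_set_def by (elim exE conjE) (rule that)
  moreover obtain \<B> where "finite \<B>" "B = \<Union>\<B>" "\<forall>B\<in>\<B>. ?P B"
    using assms(2) unfolding groupless_F_set_def by (elim exE conjE) (rule that)
  ultimately have "finite (\<A> \<union> \<B>) \<and> A \<union> B = \<Union>(\<A> \<union> \<B>) \<and> (\<forall>B\<in>\<A> \<union> \<B>. ?P B)"
    by (simp add: ball_Un)
  then show ?thesis unfolding groupless_F_set_def by (rule exI)
qed

lemma groupless_cycle_plus:
  assumes "groupless_F_set F A" "d > 0"
  shows "groupless_F_set F (F_cycle F d a + A)"
proof -
  let ?P = "\<lambda>B. \<exists>\<gamma> cs. (\<forall>(a, r)\<in>set cs. r > 0) \<and> B = {\<gamma>} + (\<Sum>(a, r)\<leftarrow>cs. F_cycle F r a)"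
  obtain \<A> where \<A>: "finite \<A>" "A = \<Union>\<A>" "\<forall>B\<in>\<A>. ?P B"
    using assms(1) unfolding groupless_F_set_def by (elim exE conjE) (rule that)
  let ?\<B> = "(\<lambda>B. F_cycle F d a + B) ` \<A>"
  have "?P (F_cycle F d a + B)" if B_in: "B \<in> \<A>" for B
  proof -
    obtain \<gamma> cs where B: "\<forall>(a, r)\<in>set cs. r > 0" "B = {\<gamma>} + (\<Sum>(a, r)\<leftarrow>cs. F_cycle F r a)"
      using \<A>(3)[THEN bspec, OF B_in] by (elim exE conjE) (rule that)
    then have "(\<forall>(a, r)\<in>set ((a, d) # cs). r > 0)
      \<and> F_cycle F d a + B = {\<gamma>} + (\<Sum>(a, r)\<leftarrow>(a, d) # cs. F_cycle F r a)"
      using assms(2) by (simp add: add.left_commute)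
    then show ?thesis by (intro exI)
  qed
  moreover have "F_cycle F d a + A = \<Union>?\<B>"
    unfolding \<A>(2) set_plus_def by blast
  ultimately have "finite ?\<B> \<and> F_cycle F d a + A = \<Union>?\<B> \<and> (\<forall>B\<in>?\<B>. ?P B)"
    using \<A>(1) by simp
  then show ?thesis unfolding groupless_F_set_def by (rule exI)
qed

lemma boolean_combinations_Diff:
  "X \<in> boolean_combinations \<B> \<Longrightarrow> Y \<in> boolean_combinations \<B> \<Longrightarrow> X - Y \<in> boolean_combinations \<B>"
  unfolding Diff_eq by (intro boolean_combinations.inter boolean_combinations.compl)

lemma boolean_combinations_Union:
  assumes "finite \<A>" "\<A> \<subseteq> boolean_combinations \<B>" "\<B> \<noteq> {}"
  shows "\<Union>\<A> \<in> boolean_combinations \<B>"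
  using assms(1,2)
proof (induction \<A> rule: finite_induct)
  case empty
  obtain X where "X \<in> \<B>" using assms(3) by blast
  then have "X \<in> boolean_combinations \<B>" by (rule boolean_combinations.base)
  from boolean_combinations_Diff[OF this this] show ?case by simp
qed (simp add: boolean_combinations.union)

context spanning_period
begin

lemma val_insert: "finite I \<Longrightarrow> i \<notin> I \<Longrightarrow> val \<gamma> (insert i I) v e = cyc (v i) (e i) + val \<gamma> I v e"
  by (simp add: val_def algebra_simps)

lemma box_insert:
  assumes "finite I" "i \<notin> I"
  shows "box \<gamma> (insert i I) v = {cyc (v i) n | n. True} + box \<gamma> I v"
proof (intro equalityI subsetI)
  fix x assume "x \<in> box \<gamma> (insert i I) v"
  then obtain e where "x = cyc (v i) (e i) + val \<gamma> I v e"
    unfolding box_def val_insert[OF assms] by blast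
  then show "x \<in> {cyc (v i) n | n. True} + box \<gamma> I v" unfolding box_def by blast
next
  fix x assume "x \<in> {cyc (v i) n | n. True} + box \<gamma> I v"
  then obtain n e where "x = cyc (v i) n + val \<gamma> I v e"
    unfolding box_def set_plus_def by blast
  also have "val \<gamma> I v e = val \<gamma> I v (e(i := n))" using assms(2) by (intro val_cong) auto
  also have "cyc (v i) n + \<dots> = val \<gamma> (insert i I) v (e(i := n))"
    unfolding val_insert[OF assms] by simp
  finally show "x \<in> box \<gamma> (insert i I) v" unfolding box_def by blast
qed

lemma box_groupless:
  assumes "finite I" and G: "\<And>i. G ^^ i = F ^^ (d * i)" and "d > 0"
  shows "groupless_F_set F (box \<gamma> I v)"
  using assms(1)
proof (induction I rule: finite_induct)
  case empty
  have "box \<gamma> {} v = {\<gamma>}" by (simp add: box_def val_def)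
  then show ?case by (simp add: groupless_singleton)
next
  case (insert i I)
  \<comment> \<open>\<open>cyc\<close> may have no terms, while an \<open>F_cycle\<close> starts
    with one; the extra point \<open>0\<close> contributes a copy of the box over
    \<open>I\<close>.\<close>
  have "{cyc (v i) n | n. True} = insert 0 (F_cycle F d (v i))"
  proof (intro equalityI subsetI)
    fix x assume "x \<in> {cyc (v i) n | n. True}"
    then obtain n where n: "x = cyc (v i) n" by blast
    show "x \<in> insert 0 (F_cycle F d (v i))"
    proof (cases n)
      case (Suc m)
      then have "x = (\<Sum>j\<le>m. (F ^^ (d * j)) (v i))" by (simp only: n cyc_def G lessThan_Suc_atMost)
      then show ?thesis unfolding F_cycle_def by blast
    qed (simp add: n)
  next
    fix x assume "x \<in> insert 0 (F_cycle F d (v i))"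
    then consider "x = 0" | n where "x = (\<Sum>j\<le>n. (F ^^ (d * j)) (v i))"
      unfolding F_cycle_def by blast
    then show "x \<in> {cyc (v i) n | n. True}"
    proof cases
      case 1
      then have "x = cyc (v i) 0" by simp
      then show ?thesis by blast
    next
      case (2 n)
      then have "x = cyc (v i) (Suc n)" by (simp only: cyc_def G lessThan_Suc_atMost)
      then show ?thesis by blast
    qed
  qed
  then have "box \<gamma> (insert i I) v = insert 0 (F_cycle F d (v i)) + box \<gamma> I v"
    using box_insert[OF insert.hyps] by simp
  also have "\<dots> = box \<gamma> I v \<union> (F_cycle F d (v i) + box \<gamma> I v)"
    unfolding set_plus_def by force
  finally show ?case
    using groupless_Un[OF insert.IH groupless_cycle_plus[OF insert.IH \<open>d > 0\<close>]] by simp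
qed

text \<open>The non-generic points of a box lie in finitely many boxes of smaller dimension, obtained by
  fixing one exponent or by tying two exponents together.\<close>

lemma not_far_cover:
  fixes I :: "nat set"
  assumes I: "finite I" "v ` I \<subseteq> H"
  shows "\<exists>\<L>. finite \<L> \<and>
    (\<forall>(\<gamma>', J, w)\<in>\<L>. finite J \<and> card J < card I \<and> w ` J \<subseteq> H) \<and>
    (\<forall>e. \<not> far K e I \<longrightarrow> (\<exists>(\<gamma>', J, w)\<in>\<L>. val \<gamma> I v e \<in> box \<gamma>' J w))"
proof -
  define L1 where "L1 = (\<lambda>(i, q). (\<gamma> + cyc (v i) q, I - {i}, v)) ` (I \<times> {..<K})"
  \<comment> \<open>If \<open>e i = q + e j\<close>, then \<open>cyc_shift\<close> splits the
    \<open>i\<close>-th cycle into the constant \<open>cyc (v i) q\<close> and a cycle of the same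
    length as the \<open>j\<close>-th, whose coefficient absorbs it.\<close>
  define L2 where "L2 = (\<lambda>(i, j, q). (\<gamma> + cyc (v i) q, I - {i}, v(j := v j + (G ^^ q) (v i)))) ` (I \<times> I \<times> {..<K})"
  have val_remove: "val \<gamma> I v e = val (\<gamma> + cyc (v i) (e i)) (I - {i}) v e" if "i \<in> I" for i e
    using that I(1) by (simp add: val_def sum.remove[of I i] add.assoc)
  have cover: "\<exists>(\<gamma>', J, w)\<in>L1 \<union> L2. val \<gamma> I v e \<in> box \<gamma>' J w" if far: "\<not> far K e I" for e
  proof (cases "\<exists>i\<in>I. e i < K")
    case True
    then obtain i where i: "i \<in> I" "e i < K" by blast
    have "val \<gamma> I v e \<in> box (\<gamma> + cyc (v i) (e i)) (I - {i}) v"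
      unfolding val_remove[OF i(1)] box_def by blast
    moreover have "(\<gamma> + cyc (v i) (e i), I - {i}, v) \<in> L1" using i unfolding L1_def by force
    ultimately show ?thesis by blast
  next
    case False
    then obtain i0 j0 where ij0: "i0 \<in> I" "j0 \<in> I" "i0 \<noteq> j0" "e i0 < e j0 + K" "e j0 < e i0 + K"
      using far unfolding far_def spread_def by (meson not_le)
    obtain i j q where ij: "i \<in> I" "j \<in> I" "i \<noteq> j" "e i = q + e j" "q < K"
    proof (cases "e j0 \<le> e i0")
      case True
      then show ?thesis using ij0 by (intro that[of i0 j0 "e i0 - e j0"]) auto
    next
      case False
      then show ?thesis using ij0 by (intro that[of j0 i0 "e j0 - e i0"]) auto
    qed
    let ?w = "v(j := v j + (G ^^ q) (v i))"
    have j: "j \<in> I - {i}" "finite (I - {i})" using ij I(1) by auto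
    have "val \<gamma> I v e = val (\<gamma> + cyc (v i) q) (I - {i}) v e + cyc ((G ^^ q) (v i)) (e j)"
      unfolding val_remove[OF ij(1)] by (simp add: val_def ij(4) cyc_shift G_pow_cyc algebra_simps)
    also have "\<dots> = val (\<gamma> + cyc (v i) q) (I - {i}) ?w e"
      by (simp add: val_def sum.remove[OF j(2,1)] cyc_add algebra_simps)
    finally have "val \<gamma> I v e \<in> box (\<gamma> + cyc (v i) q) (I - {i}) ?w" unfolding box_def by blast
    moreover have "(\<gamma> + cyc (v i) q, I - {i}, ?w) \<in> L2" using ij unfolding L2_def by force
    ultimately show ?thesis by blast
  qed
  have H: "(\<gamma>', J, w) \<in> L1 \<union> L2 \<Longrightarrow> finite J \<and> card J < card I \<and> w ` J \<subseteq> H" for \<gamma>' J w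
  proof -
    assume "(\<gamma>', J, w) \<in> L1 \<union> L2"
    then consider i where "i \<in> I" "J = I - {i}" "w = v"
      | i j q where "i \<in> I" "j \<in> I" "J = I - {i}" "w = v(j := v j + (G ^^ q) (v i))"
      unfolding L1_def L2_def by auto
    then show ?thesis
    proof cases
      case 1
      then show ?thesis using I card_Diff1_less[OF I(1)] by auto
    next
      case 2
      have "v j + (G ^^ q) (v i) \<in> H" using I(2) 2(1,2) by (intro H_add H_G_pow) auto
      then show ?thesis using I card_Diff1_less[OF I(1)] 2 by auto
    qed
  qed
  have "finite (L1 \<union> L2)" unfolding L1_def L2_def using I(1) by simp
  moreover have "case x of (\<gamma>', J, w) \<Rightarrow> finite J \<and> card J < card I \<and> w ` J \<subseteq> H"
    if "x \<in> L1 \<union> L2" for x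
    using H[of "fst x" "fst (snd x)" "snd (snd x)"] that by (simp add: split_beta)
  ultimately show ?thesis using cover by (intro exI[of _ "L1 \<union> L2"] conjI ballI allI impI)
qed

text \<open>By genericity either \<open>A\<close> or its complement in the box has only points with
  non-far exponents. Such a set is covered by finitely many boxes of smaller dimension, and its
  trace on each of them is again generic.\<close>

lemma generic_boolean_combination:
  assumes \<B>: "\<And>\<gamma> I v. finite I \<Longrightarrow> box \<gamma> I v \<in> \<B>"
    and "finite I" "v ` I \<subseteq> H" "generic A" "A \<subseteq> box \<gamma> I v"
  shows "A \<in> boolean_combinations \<B>"
  using assms(2-)
proof (induction "card I" arbitrary: \<gamma> I v A rule: less_induct)
  case less
  note I = less.prems(1,2)
  obtain K where K: "(\<forall>e. far K e I \<longrightarrow> val \<gamma> I v e \<in> A) \<or> (\<forall>e. far K e I \<longrightarrow> val \<gamma> I v e \<notin> A)"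
    using less.prems(3) I unfolding generic_def by blast
  obtain \<L> where \<L>: "finite \<L>"
    "\<forall>(\<gamma>', J, w)\<in>\<L>. finite J \<and> card J < card I \<and> w ` J \<subseteq> H"
    "\<forall>e. \<not> far K e I \<longrightarrow> (\<exists>(\<gamma>', J, w)\<in>\<L>. val \<gamma> I v e \<in> box \<gamma>' J w)"
    using not_far_cover[OF I, of K \<gamma>] by (elim exE conjE) (rule that)
  have small: "B \<in> boolean_combinations \<B>"
    if B: "generic B" "\<And>x. x \<in> B \<Longrightarrow> \<exists>e. x = val \<gamma> I v e \<and> \<not> far K e I" for B
  proof -
    let ?\<A> = "(\<lambda>(\<gamma>', J, w). B \<inter> box \<gamma>' J w) ` \<L>"
    have eq: "B = \<Union>?\<A>"
    proof (intro equalityI subsetI)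
      fix x assume "x \<in> B"
      then obtain \<gamma>' J w where "(\<gamma>', J, w) \<in> \<L>" "x \<in> box \<gamma>' J w"
        using B(2)[of x] \<L>(3) by blast
      then show "x \<in> \<Union>?\<A>" using \<open>x \<in> B\<close> by blast
    qed auto
    have "B \<inter> box \<gamma>' J w \<in> boolean_combinations \<B>" if L: "(\<gamma>', J, w) \<in> \<L>" for \<gamma>' J w
    proof -
      have J: "finite J" "card J < card I" "w ` J \<subseteq> H" using \<L>(2) L by blast+
      show ?thesis
        by (rule less.hyps[OF J(2,1,3) generic_Int[OF B(1) box_generic[OF J(1,3)]] Int_lower2])
    qed
    then have "?\<A> \<subseteq> boolean_combinations \<B>" by (auto simp: image_subset_iff)
    moreover have "\<B> \<noteq> {}" using \<B>[OF I(1)] by blast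
    ultimately have "\<Union>?\<A> \<in> boolean_combinations \<B>"
      by (intro boolean_combinations_Union finite_imageI \<L>(1))
    then show ?thesis by (simp only: eq[symmetric])
  qed
  have box: "box \<gamma> I v \<in> boolean_combinations \<B>"
    using \<B>[OF I(1)] by (rule boolean_combinations.base)
  from K show ?case
  proof
    assume far: "\<forall>e. far K e I \<longrightarrow> val \<gamma> I v e \<notin> A"
    show ?thesis
    proof (rule small[OF less.prems(3)])
      fix x assume "x \<in> A"
      then obtain e where "x = val \<gamma> I v e" using less.prems(4) unfolding box_def by blast
      then show "\<exists>e. x = val \<gamma> I v e \<and> \<not> far K e I" using far \<open>x \<in> A\<close> by blast
    qed
  next
    assume far: "\<forall>e. far K e I \<longrightarrow> val \<gamma> I v e \<in> A"
    have "box \<gamma> I v - A \<in> boolean_combinations \<B>"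
      unfolding Diff_eq
    proof (rule small)
      show "generic (box \<gamma> I v \<inter> - A)"
        by (intro generic_Int box_generic generic_Compl I less.prems(3))
      fix x assume x: "x \<in> box \<gamma> I v \<inter> - A"
      then obtain e where "x = val \<gamma> I v e" unfolding box_def by blast
      then show "\<exists>e. x = val \<gamma> I v e \<and> \<not> far K e I" using far x by blast
    qed
    then have "box \<gamma> I v - (box \<gamma> I v - A) \<in> boolean_combinations \<B>"
      by (rule boolean_combinations_Diff[OF box])
    moreover have "box \<gamma> I v - (box \<gamma> I v - A) = A" using less.prems(4) by blast
    ultimately show ?thesis by simp
  qed
qed

text \<open>Forgetting the order of the exponents encloses each piece in a box. Genericity is known
  for the union, so it is the trace of the whole union on each box that is treated.\<close>

lemma stable_pieces_boolean_combination:
  assumes "finite \<P>" "\<And>B. B \<in> \<P> \<Longrightarrow> \<exists>\<gamma> k v. v ` {..<k} \<subseteq> H \<and> B = piece \<gamma> k v"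
    and "stable_set (\<Union>\<P>)" and \<B>: "\<And>\<gamma> I v. finite I \<Longrightarrow> box \<gamma> I v \<in> \<B>"
  shows "\<Union>\<P> \<in> boolean_combinations \<B>"
proof -
  have "ordered_generic (\<Union>\<P>)"
    using assms(1,2) piece_ordered_generic by (intro ordered_generic_Union) blast+
  then have gen: "generic (\<Union>\<P>)" using assms(3) by (rule stable_imp_generic)
  obtain \<gamma> k v where P: "\<And>B. B \<in> \<P> \<Longrightarrow> v B ` {..<k B} \<subseteq> H \<and> B = piece (\<gamma> B) (k B) (v B)"
    using assms(2) by metis
  define b where "b B = box (\<gamma> B) {..<k B} (v B)" for B
  have sub: "B \<subseteq> b B" if "B \<in> \<P>" for B
  proof -
    have "piece (\<gamma> B) (k B) (v B) \<subseteq> b B" unfolding b_def piece_def box_def by blast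
    then show ?thesis using P[OF that] by simp
  qed
  have "\<Union>\<P> \<inter> b B \<in> boolean_combinations \<B>" if "B \<in> \<P>" for B
  proof (rule generic_boolean_combination[OF \<B>])
    show H: "v B ` {..<k B} \<subseteq> H" using P[OF that] by blast
    show "generic (\<Union>\<P> \<inter> b B)"
      unfolding b_def by (rule generic_Int[OF gen box_generic[OF finite_lessThan H]])
    show "\<Union>\<P> \<inter> b B \<subseteq> box (\<gamma> B) {..<k B} (v B)" unfolding b_def by blast
  qed simp_all
  then have "\<Union>((\<lambda>B. \<Union>\<P> \<inter> b B) ` \<P>) \<in> boolean_combinations \<B>"
    using assms(1) \<B>[of "{}"] by (intro boolean_combinations_Union) auto
  moreover have "\<Union>((\<lambda>B. \<Union>\<P> \<inter> b B) ` \<P>) = \<Union>\<P>" using sub by blast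
  ultimately show ?thesis by simp
qed

end

section \<open>Sparse regular languages\<close>

text \<open>Each monomial is negligible against \<open>2 ^ m = exp (ln 2 * m)\<close>. This will
  contradict polynomial growth.\<close>

lemma poly_less_power2: "\<exists>m. poly q (real m) < 2 ^ m"
proof -
  have lim: "(\<lambda>m. real m ^ k / 2 ^ m) \<longlonglongrightarrow> 0" for k
  proof -
    have "filterlim (\<lambda>m. ln 2 * real m) at_top sequentially"
      by (rule filterlim_tendsto_pos_mult_at_top[OF tendsto_const _ filterlim_real_sequentially]) simp
    then have "(\<lambda>m. (ln 2 * real m) ^ k / exp (ln 2 * real m)) \<longlonglongrightarrow> 0"
      by (rule filterlim_compose[OF tendsto_power_div_exp_0])
    moreover have "(ln 2 * real m) ^ k / exp (ln 2 * real m) = ln 2 ^ k * (real m ^ k / 2 ^ m)" for m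
      by (simp add: exp_of_nat2_mult power_mult_distrib)
    ultimately have "(\<lambda>m. ln 2 ^ k * (real m ^ k / 2 ^ m)) \<longlonglongrightarrow> 0"
      by (simp only:)
    then have "(\<lambda>m. 1 / ln 2 ^ k * (ln 2 ^ k * (real m ^ k / 2 ^ m))) \<longlonglongrightarrow> 1 / ln 2 ^ k * 0"
      by (intro tendsto_mult_left)
    moreover have "1 / ln 2 ^ k * (ln 2 ^ k * (real m ^ k / 2 ^ m)) = real m ^ k / 2 ^ m" for m
      by (simp add: field_simps)
    ultimately show ?thesis by (simp only: mult_zero_right)
  qed
  have "(\<lambda>m. \<Sum>i\<le>degree q. coeff q i * (real m ^ i / 2 ^ m)) \<longlonglongrightarrow> (\<Sum>i\<le>degree q. coeff q i * 0)"
    by (intro tendsto_sum tendsto_mult tendsto_const lim)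
  moreover have "(\<Sum>i\<le>degree q. coeff q i * (real m ^ i / 2 ^ m)) = poly q (real m) / 2 ^ m" for m
    by (simp add: poly_altdef sum_divide_distrib)
  ultimately have "(\<lambda>m. poly q (real m) / 2 ^ m) \<longlonglongrightarrow> 0"
    by (simp only: mult_zero_right sum.neutral_const)
  then have "eventually (\<lambda>m. poly q (real m) / 2 ^ m < 1) sequentially"
    by (rule order_tendstoD(2)) simp
  then obtain m where "poly q (real m) / 2 ^ m < 1"
    unfolding eventually_sequentially by blast
  then have "poly q (real m) < 2 ^ m" by (simp add: divide_less_eq)
  then show ?thesis ..
qed

text \<open>The languages \<open>u0 z1* u1 ... zk* uk\<close> with the \<open>zi\<close> in
  \<open>Z\<close>. Building them from the right matches the evaluation of strings, where a prefix
  acts by adding a constant to a shifted value.\<close>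

inductive_set simple :: "'b set \<Rightarrow> 'b list set \<Rightarrow> 'b list set set" for \<Lambda> Z
  where
    nil: "{[]} \<in> simple \<Lambda> Z"
  | cons: "X \<in> simple \<Lambda> Z \<Longrightarrow> s \<in> \<Lambda> \<Longrightarrow> (#) s ` X \<in> simple \<Lambda> Z"
  | loop: "X \<in> simple \<Lambda> Z \<Longrightarrow> z \<in> Z \<Longrightarrow> {concat (replicate n z) @ x | n x. x \<in> X} \<in> simple \<Lambda> Z"

lemma simple_append: "X \<in> simple \<Lambda> Z \<Longrightarrow> u \<in> lists \<Lambda> \<Longrightarrow> (@) u ` X \<in> simple \<Lambda> Z"
proof (induction u)
  case (Cons s u)
  then have "(#) s ` ((@) u ` X) \<in> simple \<Lambda> Z" by (intro simple.cons) simp_all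
  then show ?case by (simp add: image_image)
qed simp

section \<open>Loops in an automaton of polynomial growth\<close>

locale automaton =
  fixes \<Lambda> :: "'b set" and Q T :: "nat set" and \<delta> :: "nat \<Rightarrow> 'b \<Rightarrow> nat"
  assumes finite_\<Lambda>: "finite \<Lambda>" and finite_Q: "finite Q"
    and step: "q \<in> Q \<Longrightarrow> s \<in> \<Lambda> \<Longrightarrow> \<delta> q s \<in> Q"
begin

definition accepted :: "nat \<Rightarrow> 'b list set"
  where "accepted q = {w \<in> lists \<Lambda>. foldl \<delta> q w \<in> T}"

definition loops :: "nat \<Rightarrow> 'b list set"
  where "loops q = {u \<in> lists \<Lambda>. foldl \<delta> q u = q}"

definition accepted_within :: "nat set \<Rightarrow> nat \<Rightarrow> 'b list set"
  where "accepted_within R q = {w \<in> accepted q. \<forall>u v. w = u @ v \<longrightarrow> foldl \<delta> q u \<in> R}"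

lemma loops_append: "u \<in> loops q \<Longrightarrow> v \<in> loops q \<Longrightarrow> u @ v \<in> loops q"
  by (simp add: loops_def)

lemma loops_concat: "set us \<subseteq> loops q \<Longrightarrow> concat us \<in> loops q"
  by (induction us) (simp_all add: loops_append, simp add: loops_def)

lemma loops_append_accepted: "u \<in> loops q \<Longrightarrow> w \<in> accepted q \<Longrightarrow> u @ w \<in> accepted q"
  by (simp add: loops_def accepted_def)

lemma foldl_in_Q: "q \<in> Q \<Longrightarrow> w \<in> lists \<Lambda> \<Longrightarrow> foldl \<delta> q w \<in> Q"
  by (induction w arbitrary: q) (simp_all add: step)

text \<open>Two distinct loops \<open>u\<close>, \<open>v\<close> of one length could be
  concatenated freely between \<open>x\<close> and \<open>y\<close>. This yields
  \<open>2 ^ m\<close> accepted words of length linear in \<open>m\<close>; equal lengths make the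
  factorization unique.\<close>

lemma sparse_unique_loop:
  assumes sparse: "\<And>n. real (card {w \<in> accepted q0. length w \<le> n}) \<le> poly P (real n)"
    and x: "x \<in> lists \<Lambda>" "q = foldl \<delta> q0 x" and y: "y \<in> accepted q"
    and u: "u \<in> loops q" and v: "v \<in> loops q" and len: "length u = length v"
  shows "u = v"
proof (rule ccontr)
  assume "u \<noteq> v"
  define n where "n m = length x + length y + length u * m" for m
  have bound: "2 ^ m \<le> poly P (real (n m))" for m
  proof -
    let ?C = "{cs. set cs \<subseteq> {u, v} \<and> length cs = m}"
    let ?f = "\<lambda>cs. x @ concat cs @ y"
    have "inj_on ?f ?C"
    proof (rule inj_onI)
      fix cs ds assume cs: "cs \<in> ?C" and ds: "ds \<in> ?C" and eq: "?f cs = ?f ds"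
      have "length a = length b" if "(a, b) \<in> set (zip cs ds)" for a b
      proof -
        have "a \<in> {u, v}" "b \<in> {u, v}"
          using set_zip_leftD[OF that] set_zip_rightD[OF that] cs ds by auto
        then show ?thesis using len by auto
      qed
      then have lens: "\<forall>(a, b)\<in>set (zip cs ds). length a = length b" by blast
      have "concat cs = concat ds" "length cs = length ds" using eq cs ds by simp_all
      then show "cs = ds" using lens by (rule concat_injective)
    qed
    then have "card (?f ` ?C) = card ?C" by (rule card_image)
    also have "\<dots> = card {u, v} ^ m" by (rule card_lists_length_eq) simp
    also have "card {u, v} = 2" using \<open>u \<noteq> v\<close> by simp
    finally have card: "card (?f ` ?C) = 2 ^ m" .
    have "?f ` ?C \<subseteq> {w \<in> accepted q0. length w \<le> n m}"
    proof
      fix w assume "w \<in> ?f ` ?C"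
      then obtain cs where cs: "set cs \<subseteq> {u, v}" "length cs = m" "w = ?f cs" by blast
      then have "concat cs \<in> loops q" using u v by (intro loops_concat) blast
      then have "concat cs @ y \<in> accepted q" using y by (rule loops_append_accepted)
      then have "w \<in> accepted q0" using x cs(3) by (simp add: accepted_def)
      moreover have "length (concat cs) = length u * length cs"
        using cs(1)
      proof (induction cs)
        case (Cons c cs)
        then have "c = u \<or> c = v" "length (concat cs) = length u * length cs" by simp_all
        then show ?case using len by auto
      qed simp
      ultimately show "w \<in> {w \<in> accepted q0. length w \<le> n m}" using cs by (simp add: n_def)
    qed
    moreover have "finite {w \<in> accepted q0. length w \<le> n m}"
      by (rule finite_subset[OF _ finite_lists_length_le[OF finite_\<Lambda>, of "n m"]])
        (auto simp: accepted_def)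
    ultimately have "card (?f ` ?C) \<le> card {w \<in> accepted q0. length w \<le> n m}"
      by (intro card_mono)
    then have "2 ^ m \<le> card {w \<in> accepted q0. length w \<le> n m}" by (simp only: card)
    then have "2 ^ m \<le> real (card {w \<in> accepted q0. length w \<le> n m})"
      by (metis of_nat_le_iff of_nat_numeral of_nat_power)
    then show ?thesis using sparse[of "n m"] by (rule order_trans)
  qed
  \<comment> \<open>The growth bound as a polynomial in \<open>m\<close>, by substituting the length
    of the words with \<open>m\<close> loops.\<close>
  define P' where "P' = pcompose P [:real (length x + length y), real (length u):]"
  obtain m where "poly P' (real m) < 2 ^ m" using poly_less_power2 by blast
  moreover have "poly P' (real m) = poly P (real (n m))"
    by (simp add: P'_def poly_pcompose n_def algebra_simps)
  ultimately show False using bound[of m] by simp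
qed

text \<open>Uniqueness of loops of a given length makes all loops at a state commute with \<open>z\<close>.\<close>

lemma loop_power:
  assumes uniq: "\<And>u v. u \<in> loops q \<Longrightarrow> v \<in> loops q \<Longrightarrow> length u = length v \<Longrightarrow> u = v"
    and z: "z \<in> loops q" "z \<noteq> []"
  shows "u \<in> loops q \<Longrightarrow> \<exists>n u'. u = concat (replicate n z) @ u' \<and> u' \<in> loops q \<and> length u' < length z"
proof (induction "length u" arbitrary: u rule: less_induct)
  case less
  show ?case
  proof (cases "length u < length z")
    case True
    then have "u = concat (replicate 0 z) @ u \<and> u \<in> loops q \<and> length u < length z"
      using less.prems by simp
    then show ?thesis by blast
  next
    case False
    have "z @ u = u @ z"
      using loops_append[OF z(1) less.prems] loops_append[OF less.prems z(1)] by (intro uniq) simp_all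
    have "z = take (length z) (z @ u)" by simp
    also have "\<dots> = take (length z) u" unfolding \<open>z @ u = u @ z\<close> using False by simp
    finally obtain u1 where u1: "u = z @ u1" using append_take_drop_id[of "length z" u] by metis
    then have "u1 \<in> loops q" using less.prems z(1) by (simp add: loops_def)
    moreover have "length u1 < length u" using u1 z(2) by simp
    ultimately obtain n u' where "u1 = concat (replicate n z) @ u'" "u' \<in> loops q" "length u' < length z"
      using less.hyps by blast
    then have "u = concat (replicate (Suc n) z) @ u' \<and> u' \<in> loops q \<and> length u' < length z"
      using u1 by simp
    then show ?thesis by blast
  qed
qed

text \<open>Returns to \<open>q\<close> are stripped from the front into \<open>u\<close> until none
  is left.\<close>

lemma last_visit:
  assumes "w \<in> lists \<Lambda>"
  shows "\<exists>u r. w = u @ r \<and> u \<in> loops q \<and> (\<forall>r1 r2. r = r1 @ r2 \<longrightarrow> r1 \<noteq> [] \<longrightarrow> foldl \<delta> q r1 \<noteq> q)"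
  using assms
proof (induction "length w" arbitrary: w rule: less_induct)
  case less
  show ?case
  proof (cases "\<exists>r1 r2. w = r1 @ r2 \<and> r1 \<noteq> [] \<and> foldl \<delta> q r1 = q")
    case True
    then obtain r1 r2 where r: "w = r1 @ r2" "r1 \<noteq> []" "foldl \<delta> q r1 = q" by blast
    then have "length r2 < length w" "r2 \<in> lists \<Lambda>" and r1: "r1 \<in> loops q"
      using less.prems by (simp_all add: loops_def)
    then obtain u r' where u: "r2 = u @ r'" "u \<in> loops q"
      "\<forall>r1 r2. r' = r1 @ r2 \<longrightarrow> r1 \<noteq> [] \<longrightarrow> foldl \<delta> q r1 \<noteq> q"
      using less.hyps by blast
    then have "w = (r1 @ u) @ r'" "r1 @ u \<in> loops q" using r(1) loops_append[OF r1] by simp_all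
    then show ?thesis using u(3) by (intro exI conjI)
  next
    case False
    have "w = [] @ w" "[] \<in> loops q" by (simp_all add: loops_def)
    moreover have "\<forall>r1 r2. w = r1 @ r2 \<longrightarrow> r1 \<noteq> [] \<longrightarrow> foldl \<delta> q r1 \<noteq> q" using False by blast
    ultimately show ?thesis by (intro exI conjI)
  qed
qed


text \<open>Splitting a run at its last visit to \<open>q\<close> leaves a loop at \<open>q\<close> and a run that avoids \<open>q\<close>, so that
  induction on the set of allowed states applies. The upper bound is the full accepted language, as
  powers of loops need not stay within the allowed states.\<close>

lemma simple_decomposition:
  assumes uniq: "\<And>q u v. \<lbrakk>reachable q; accepted q \<noteq> {}; u \<in> loops q; v \<in> loops q; length u = length v\<rbrakk> \<Longrightarrow> u = v"
    and loopZ: "\<And>q. \<lbrakk>reachable q; loops q \<noteq> {[]}\<rbrakk> \<Longrightarrow> \<exists>z\<in>Z. z \<in> loops q \<and> z \<noteq> []"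
    and reach: "\<And>q s. reachable q \<Longrightarrow> s \<in> \<Lambda> \<Longrightarrow> reachable (\<delta> q s)"
  shows "finite R \<Longrightarrow> reachable q \<Longrightarrow> \<exists>\<X>. finite \<X> \<and> \<X> \<subseteq> simple \<Lambda> Z \<and>
    accepted_within R q \<subseteq> \<Union>\<X> \<and> \<Union>\<X> \<subseteq> accepted q"
proof (induction "card R" arbitrary: R q rule: less_induct)
  case less
  show ?case
  proof (cases "q \<in> R \<and> accepted q \<noteq> {}")
    case False
    have "accepted_within R q = {}"
    proof (rule ccontr)
      assume "accepted_within R q \<noteq> {}"
      then obtain w where w: "w \<in> accepted q" "\<forall>u v. w = u @ v \<longrightarrow> foldl \<delta> q u \<in> R"
        unfolding accepted_within_def by blast
      have "foldl \<delta> q [] \<in> R" using w(2) append_Nil by metis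
      then show False using False w(1) by auto
    qed
    then show ?thesis by (intro exI[of _ "{}"]) simp
  next
    case True
    have "card (R - {q}) < card R" using True less.prems(1) by (intro card_Diff1_less) simp_all
    then have "\<exists>\<X>. finite \<X> \<and> \<X> \<subseteq> simple \<Lambda> Z \<and>
        accepted_within (R - {q}) (\<delta> q s) \<subseteq> \<Union>\<X> \<and> \<Union>\<X> \<subseteq> accepted (\<delta> q s)" if "s \<in> \<Lambda>" for s
      using less.hyps[of "R - {q}" "\<delta> q s"] less.prems reach that by simp
    then obtain \<X> where \<X>: "\<And>s. s \<in> \<Lambda> \<Longrightarrow> finite (\<X> s)" "\<And>s. s \<in> \<Lambda> \<Longrightarrow> \<X> s \<subseteq> simple \<Lambda> Z"
      "\<And>s. s \<in> \<Lambda> \<Longrightarrow> accepted_within (R - {q}) (\<delta> q s) \<subseteq> \<Union>(\<X> s)"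
      "\<And>s. s \<in> \<Lambda> \<Longrightarrow> \<Union>(\<X> s) \<subseteq> accepted (\<delta> q s)"
      by metis
    \<comment> \<open>Languages for the part of a run after its last visit to \<open>q\<close>: stop
      at once, or read \<open>s\<close> and continue within \<open>R - {q}\<close>.\<close>
    define \<Y> where "\<Y> = (if q \<in> T then {{[]}} else {}) \<union> (\<Union>s\<in>\<Lambda>. (\<lambda>X. (#) s ` X) ` \<X> s)"
    have \<Y>: "finite \<Y>" "\<Y> \<subseteq> simple \<Lambda> Z"
      unfolding \<Y>_def using \<X>(1,2) finite_\<Lambda> by (auto intro!: simple.nil simple.cons)
    have \<Y>_acc: "x \<in> accepted q" if x: "x \<in> \<Union>\<Y>" for x
    proof -
      consider "x = []" "q \<in> T" | s X y where "s \<in> \<Lambda>" "X \<in> \<X> s" "y \<in> X" "x = s # y"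
        using x unfolding \<Y>_def by (auto split: if_splits)
      then show ?thesis
      proof cases
        case 2
        then have "y \<in> accepted (\<delta> q s)" using \<X>(4)[OF 2(1)] by blast
        then show ?thesis using 2 by (simp add: accepted_def)
      qed (simp add: accepted_def)
    qed
    have split: "\<exists>u r. w = u @ r \<and> u \<in> loops q \<and> r \<in> \<Union>\<Y>" if w: "w \<in> accepted_within R q" for w
    proof -
      have w_lists: "w \<in> lists \<Lambda>" using w unfolding accepted_within_def accepted_def by blast
      obtain u r where ur: "w = u @ r" "u \<in> loops q"
        and avoid: "\<forall>r1 r2. r = r1 @ r2 \<longrightarrow> r1 \<noteq> [] \<longrightarrow> foldl \<delta> q r1 \<noteq> q"
        using last_visit[OF w_lists, of q] by (elim exE conjE) (rule that)
      have u: "foldl \<delta> q u = q" using ur(2) by (simp add: loops_def)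
      have r: "r \<in> lists \<Lambda>" "foldl \<delta> q r \<in> T"
        using w ur(1) u unfolding accepted_within_def accepted_def by auto
      have "r \<in> \<Union>\<Y>"
      proof (cases r)
        case Nil
        then show ?thesis using r by (simp add: \<Y>_def)
      next
        case (Cons s y)
        have s: "s \<in> \<Lambda>" using r(1) Cons by simp
        have "y \<in> accepted_within (R - {q}) (\<delta> q s)"
          unfolding accepted_within_def
        proof (intro CollectI conjI allI impI)
          show "y \<in> accepted (\<delta> q s)" using r Cons by (simp add: accepted_def)
          fix a b assume ab: "y = a @ b"
          have "foldl \<delta> q (s # a) \<noteq> q" using avoid ab Cons by (metis append_Cons list.distinct(1))
          moreover have "foldl \<delta> q (u @ s # a) \<in> R"
          proof -
            have "w = (u @ s # a) @ b" using ur(1) ab Cons by simp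
            moreover have "\<forall>u v. w = u @ v \<longrightarrow> foldl \<delta> q u \<in> R"
              using w unfolding accepted_within_def by simp
            ultimately show ?thesis by blast
          qed
          ultimately show "foldl \<delta> (\<delta> q s) a \<in> R - {q}" using u by simp
        qed
        then obtain X where "X \<in> \<X> s" "y \<in> X" using \<X>(3)[OF s] by blast
        then show ?thesis unfolding \<Y>_def Cons using s by blast
      qed
      then show ?thesis using ur by (intro exI conjI)
    qed
    show ?thesis
    proof (cases "loops q = {[]}")
      case True
      have "accepted_within R q \<subseteq> \<Union>\<Y>"
      proof
        fix w assume "w \<in> accepted_within R q"
        then obtain u r where "w = u @ r" "u \<in> loops q" "r \<in> \<Union>\<Y>" using split by blast
        then show "w \<in> \<Union>\<Y>" using True by simp
      qed
      then show ?thesis using \<Y> \<Y>_acc by (intro exI[of _ \<Y>]) blast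
    next
      case False
      then obtain z where z: "z \<in> Z" "z \<in> loops q" "z \<noteq> []" using loopZ less.prems(2) by blast
      \<comment> \<open>The finitely many possible remainders of a loop after removing powers of
        \<open>z\<close>, by \<open>loop_power\<close>.\<close>
      define U where "U = {u \<in> loops q. length u < length z}"
      have U: "finite U"
        by (rule finite_subset[OF _ finite_lists_length_le[OF finite_\<Lambda>, of "length z"]])
          (auto simp: U_def loops_def)
      define f where "f u X = {concat (replicate n z) @ x | n x. x \<in> (@) u ` X}" for u X
      define \<W> where "\<W> = (\<lambda>(u, X). f u X) ` (U \<times> \<Y>)"
      have "finite \<W>" unfolding \<W>_def using U \<Y>(1) by simp
      moreover have "\<W> \<subseteq> simple \<Lambda> Z"
      proof
        fix W assume "W \<in> \<W>"
        then obtain u X where uX: "u \<in> U" "X \<in> \<Y>" "W = f u X" unfolding \<W>_def by blast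
        then have "X \<in> simple \<Lambda> Z" "u \<in> lists \<Lambda>" using \<Y>(2) by (auto simp: U_def loops_def)
        then show "W \<in> simple \<Lambda> Z"
          unfolding uX(3) f_def using z(1) by (intro simple.loop simple_append)
      qed
      moreover have "accepted_within R q \<subseteq> \<Union>\<W>"
      proof
        fix w assume "w \<in> accepted_within R q"
        then obtain v r where v: "w = v @ r" "v \<in> loops q" "r \<in> \<Union>\<Y>" using split by blast
        have "u = v" if "u \<in> loops q" "v \<in> loops q" "length u = length v" for u v
          using uniq less.prems(2) True that by blast
        then obtain n u where u: "v = concat (replicate n z) @ u" "u \<in> loops q" "length u < length z"
          using loop_power[OF _ z(2,3) v(2)] by blast
        obtain X where X: "X \<in> \<Y>" "r \<in> X" using v(3) by blast
        have "w = concat (replicate n z) @ (u @ r)" using v(1) u(1) by simp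
        then have "w \<in> f u X" unfolding f_def using X(2) by blast
        moreover have "u \<in> U" using u by (simp add: U_def)
        ultimately show "w \<in> \<Union>\<W>" unfolding \<W>_def using X(1) by blast
      qed
      moreover have "\<Union>\<W> \<subseteq> accepted q"
      proof
        fix w assume "w \<in> \<Union>\<W>"
        then obtain u X n x where w: "u \<in> U" "X \<in> \<Y>" "x \<in> X" "w = concat (replicate n z) @ u @ x"
          unfolding \<W>_def f_def by blast
        have "x \<in> accepted q" using \<Y>_acc w(2,3) by blast
        moreover have "u \<in> loops q" using w(1) by (simp add: U_def)
        moreover have "concat (replicate n z) \<in> loops q"
          using z(2) by (intro loops_concat) (auto simp: set_replicate_conv_if)
        ultimately show "w \<in> accepted q" unfolding w(4) by (intro loops_append_accepted)
      qed
      ultimately show ?thesis by (intro exI[of _ \<W>] conjI)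
    qed
  qed
qed

end

text \<open>Powers of a loop are loops, so one length \<open>p\<close> serves all states when it is
  a multiple of a loop length at each. The modulus \<open>d\<close> comes first, leaving
  \<open>p\<close> and \<open>n\<close> free to be fitted to the core.\<close>

lemma sparse_decomposition:
  assumes "sparse_language \<Lambda> L"
  shows "\<exists>d>0. \<forall>p n. d dvd p \<longrightarrow> p > 0 \<longrightarrow> n > 0 \<longrightarrow> (\<exists>\<X>. finite \<X> \<and>
    \<X> \<subseteq> simple \<Lambda> {concat (replicate n z) | z. z \<in> lists \<Lambda> \<and> length z = p} \<and> L = \<Union>\<X>)"
proof -
  obtain Q :: "nat set" and q0 T \<delta> where fin: "finite \<Lambda>" "finite Q" and q0: "q0 \<in> Q"
    and step: "\<forall>q\<in>Q. \<forall>s\<in>\<Lambda>. \<delta> q s \<in> Q" and L: "L = {w \<in> lists \<Lambda>. foldl \<delta> q0 w \<in> T}"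
    using assms unfolding sparse_language_def regular_language_def by (elim exE conjE) (rule that)
  obtain P where P: "\<forall>n::nat. real (card {w \<in> L. length w \<le> n}) \<le> poly P (real n)"
    using assms unfolding sparse_language_def by (elim exE conjE) (rule that)
  interpret automaton \<Lambda> Q T \<delta>
    by unfold_locales (rule fin, rule fin, rule step[rule_format])
  have L_acc: "L = accepted q0" by (simp only: L accepted_def)
  define reachable where "reachable q \<longleftrightarrow> (\<exists>x\<in>lists \<Lambda>. q = foldl \<delta> q0 x)" for q
  have reach_step: "reachable (\<delta> q s)" if q: "reachable q" "s \<in> \<Lambda>" for q s
  proof -
    obtain x where x: "x \<in> lists \<Lambda>" "q = foldl \<delta> q0 x" using q(1) unfolding reachable_def by blast
    have "x @ [s] \<in> lists \<Lambda>" using x(1) q(2) by simp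
    moreover have "\<delta> q s = foldl \<delta> q0 (x @ [s])" using x(2) by simp
    ultimately show ?thesis unfolding reachable_def by (intro bexI)
  qed
  have reach_Q: "q \<in> Q" if "reachable q" for q
    using that foldl_in_Q[OF q0] unfolding reachable_def by blast
  have uniq: "u = v"
    if q: "reachable q" "accepted q \<noteq> {}" and uv: "u \<in> loops q" "v \<in> loops q" "length u = length v"
    for q u v
  proof -
    obtain x where x: "x \<in> lists \<Lambda>" "q = foldl \<delta> q0 x" using q(1) unfolding reachable_def by blast
    obtain y where y: "y \<in> accepted q" using q(2) by blast
    show ?thesis by (rule sparse_unique_loop[OF P[unfolded L_acc, rule_format] x y uv])
  qed
  define pick where "pick q = (SOME u. u \<in> loops q \<and> u \<noteq> [])" for q
  have Nil_loop: "[] \<in> loops q" for q by (simp add: loops_def)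
  have pick: "pick q \<in> loops q \<and> pick q \<noteq> []" if "loops q \<noteq> {[]}" for q
  proof -
    have "\<exists>u. u \<in> loops q \<and> u \<noteq> []" using that Nil_loop by blast
    then show ?thesis unfolding pick_def by (rule someI_ex)
  qed
  \<comment> \<open>The default \<open>1\<close> for states without proper loops keeps the product
    over all states positive.\<close>
  define l where "l q = (if loops q = {[]} then 1 else length (pick q))" for q
  have "l q > 0" for q using pick[of q] by (simp add: l_def)
  then have "prod l Q > 0" by (simp add: prod_pos)
  moreover have "\<exists>\<X>. finite \<X> \<and>
      \<X> \<subseteq> simple \<Lambda> {concat (replicate n z) | z. z \<in> lists \<Lambda> \<and> length z = p} \<and> L = \<Union>\<X>"
    if p: "prod l Q dvd p" "p > 0" "n > 0" for p n
  proof -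
    let ?Z = "{concat (replicate n z) | z. z \<in> lists \<Lambda> \<and> length z = p}"
    have Z: "\<exists>z\<in>?Z. z \<in> loops q \<and> z \<noteq> []" if q: "reachable q" "loops q \<noteq> {[]}" for q
    proof -
      define u where "u = pick q"
      have u: "u \<in> loops q" "length u = l q" using pick[OF q(2)] q(2) by (simp_all add: u_def l_def)
      have "l q dvd prod l Q" using fin(2) reach_Q[OF q(1)] by (rule dvd_prodI)
      then have "l q dvd p" using p(1) by (rule dvd_trans)
      then obtain k where k: "p = l q * k" by (rule dvdE)
      define z where "z = concat (replicate k u)"
      have z: "z \<in> loops q" unfolding z_def using u(1) by (intro loops_concat) (auto simp: set_replicate_conv_if)
      have "length z = p" unfolding z_def k u(2)[symmetric] by (simp add: length_concat sum_list_replicate)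
      moreover have "z \<in> lists \<Lambda>" using z by (simp add: loops_def)
      ultimately have "concat (replicate n z) \<in> ?Z" by blast
      moreover have "concat (replicate n z) \<in> loops q"
        using z by (intro loops_concat) (auto simp: set_replicate_conv_if)
      moreover have "concat (replicate n z) \<noteq> []" using p(2,3) \<open>length z = p\<close> by (cases n) auto
      ultimately show ?thesis by blast
    qed
    have q0_reachable: "reachable q0" unfolding reachable_def by (rule bexI[of _ "[]"]) simp_all
    have "\<exists>\<X>. finite \<X> \<and> \<X> \<subseteq> simple \<Lambda> ?Z \<and> accepted_within Q q0 \<subseteq> \<Union>\<X> \<and> \<Union>\<X> \<subseteq> accepted q0"
      by (rule simple_decomposition[where reachable = reachable])
        (fact uniq Z reach_step fin(2) q0_reachable)+
    then obtain \<X> where \<X>: "finite \<X>" "\<X> \<subseteq> simple \<Lambda> ?Z" "accepted_within Q q0 \<subseteq> \<Union>\<X>"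
      "\<Union>\<X> \<subseteq> accepted q0"
      by (elim exE conjE) (rule that)
    have "accepted_within Q q0 = accepted q0"
    proof -
      have "foldl \<delta> q0 u \<in> Q" if "u @ v \<in> accepted q0" for u v
        using that foldl_in_Q[OF q0, of u] by (simp add: accepted_def)
      then show ?thesis unfolding accepted_within_def by blast
    qed
    then have "L = \<Union>\<X>" using \<X>(3,4) L_acc by blast
    then show ?thesis using \<X>(1,2) by (intro exI conjI)
  qed
  ultimately show ?thesis by blast
qed

section \<open>From simple languages to pieces\<close>

context spanning_period
begin

lemma cyc_sum: "finite I \<Longrightarrow> cyc (sum f I) e = (\<Sum>i\<in>I. cyc (f i) e)"
proof (induction I rule: finite_induct)
  case empty
  show ?case by (simp add: cyc_def G_pow_zero)
qed (simp add: cyc_add)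

lemma H_digit: "v \<in> H \<Longrightarrow> \<Phi> v \<in> H"
  using H_pow[of v 1] by simp

lemma \<Phi>_cyc: "\<Phi> (cyc v e) = cyc (\<Phi> v) e"
  by (simp add: cyc_def additive.sum[OF additive] G_pow funpow_swap1)

lemma \<Phi>_val: "\<Phi> (val \<gamma> I v e) = val (\<Phi> \<gamma>) I (\<lambda>i. \<Phi> (v i)) e"
  by (simp add: val_def additive.add[OF additive] additive.sum[OF additive] \<Phi>_cyc)

text \<open>Shifting by \<open>G ^^ n\<close> raises every exponent by \<open>n\<close>. The
  corrections, from the constant and from the first \<open>n\<close> terms of each cycle, are cycles
  with exponent \<open>n\<close>, so they merge with \<open>w\<close> into one new coefficient in
  front.\<close>

lemma G_pow_val:
  fixes v :: "nat \<Rightarrow> 'a"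
  shows "cyc w n + (G ^^ n) (val \<gamma> {..<k} v e)
    = val \<gamma> {..<Suc k} (case_nat (w + (G \<gamma> - \<gamma>) - sum v {..<k}) v) (case_nat n (\<lambda>i. n + e i))"
proof -
  have "(G ^^ n) (val \<gamma> {..<k} v e)
    = (G ^^ n) \<gamma> + (\<Sum>i<k. cyc (v i) (n + e i) - cyc (v i) n)"
    by (simp add: val_def G_pow_add G_pow_sum cyc_shift)
  also have "(G ^^ n) \<gamma> = \<gamma> + cyc (G \<gamma> - \<gamma>) n" by (rule G_pow_eq_cyc)
  finally have "cyc w n + (G ^^ n) (val \<gamma> {..<k} v e)
    = \<gamma> + cyc (w + (G \<gamma> - \<gamma>) - sum v {..<k}) n + (\<Sum>i<k. cyc (v i) (n + e i))"
    by (simp add: sum_subtractf cyc_add cyc_diff cyc_sum algebra_simps)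
  then show ?thesis
    unfolding val_def sum.lessThan_Suc_shift by (simp add: algebra_simps)
qed

lemma case_nat_mono:
  assumes "\<forall>i j. i \<le> j \<longrightarrow> j < k \<longrightarrow> e i \<le> (e j::nat)"
  shows "\<forall>i j. i \<le> j \<longrightarrow> j < Suc k \<longrightarrow> case_nat n (\<lambda>i. n + e i) i \<le> case_nat n (\<lambda>i. n + e i) j"
proof (intro allI impI)
  fix i j assume ij: "i \<le> j" "j < Suc k"
  show "case_nat n (\<lambda>i. n + e i) i \<le> case_nat n (\<lambda>i. n + e i) j"
  proof (cases i)
    case 0
    then show ?thesis by (simp split: nat.split)
  next
    case (Suc i')
    then obtain j' where "j = Suc j'" using ij(1) by (cases j) simp_all
    then show ?thesis using Suc ij assms by simp
  qed
qed

text \<open>The sequences \<open>n, n + e 0, n + e 1, ...\<close> with \<open>e\<close> monotone are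
  exactly the monotone sequences with one more term; this is where the ordering in
  \<open>piece\<close> comes from.\<close>

lemma piece_loop:
  "{cyc w n + (G ^^ n) y | n y. y \<in> piece \<gamma> k v}
    = piece \<gamma> (Suc k) (case_nat (w + (G \<gamma> - \<gamma>) - sum v {..<k}) v)" (is "?A = piece \<gamma> (Suc k) ?v")
proof (intro equalityI subsetI)
  fix x assume "x \<in> ?A"
  then obtain n e where e: "\<forall>i j. i \<le> j \<longrightarrow> j < k \<longrightarrow> e i \<le> e j"
    and x: "x = cyc w n + (G ^^ n) (val \<gamma> {..<k} v e)"
    unfolding piece_def by blast
  show "x \<in> piece \<gamma> (Suc k) ?v"
    unfolding piece_def x G_pow_val using case_nat_mono[OF e, of n] by blast
next
  fix x assume "x \<in> piece \<gamma> (Suc k) ?v"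
  then obtain e where e: "\<And>i j. i \<le> j \<Longrightarrow> j < Suc k \<Longrightarrow> e i \<le> e j"
    and x: "x = val \<gamma> {..<Suc k} ?v e"
    unfolding piece_def by blast
  define e' where "e' i = e (Suc i) - e 0" for i
  have "e i = case_nat (e 0) (\<lambda>i. e 0 + e' i) i" if "i < Suc k" for i
    using e[of 0 i] that by (cases i) (simp_all add: e'_def)
  then have "x = val \<gamma> {..<Suc k} ?v (case_nat (e 0) (\<lambda>i. e 0 + e' i))"
    unfolding x by (intro val_cong) simp
  also have "\<dots> = cyc w (e 0) + (G ^^ e 0) (val \<gamma> {..<k} v e')"
    by (rule G_pow_val[symmetric])
  also have "val \<gamma> {..<k} v e' \<in> piece \<gamma> k v"
  proof -
    have "\<forall>i j. i \<le> j \<longrightarrow> j < k \<longrightarrow> e' i \<le> e' j"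
      unfolding e'_def using e by (simp add: diff_le_mono)
    then show ?thesis unfolding piece_def by blast
  qed
  ultimately show "x \<in> ?A" by blast
qed

text \<open>Letters act by an affine map with linear part \<open>\<Phi>\<close>, which preserves
  \<open>H\<close>; each loop adds one exponent, with coefficient in \<open>H\<close> because its
  word is repeated \<open>card core\<close> times.\<close>

lemma simple_value_piece:
  assumes "X \<in> simple S {concat (replicate (card core) z) | z. z \<in> lists S \<and> length z = p}"
  shows "\<exists>\<gamma> k v. v ` {..<k} \<subseteq> H \<and> string_value \<Phi> ` X = piece \<gamma> k v"
  using assms
proof (induction rule: simple.induct)
  case nil
  have "string_value \<Phi> ` {[]} = piece 0 0 (\<lambda>_. 0)" by (simp add: piece_def val_def)
  then show ?case by (intro exI conjI) simp_all
next
  case (cons X s)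
  then obtain \<gamma> k v where v: "v ` {..<k} \<subseteq> H" and X: "string_value \<Phi> ` X = piece \<gamma> k v" by blast
  have "string_value \<Phi> ` ((#) s ` X) = (\<lambda>y. s + \<Phi> y) ` string_value \<Phi> ` X"
    by (simp add: image_image string_value_Cons[OF additive])
  also have "\<dots> = piece (s + \<Phi> \<gamma>) k (\<lambda>i. \<Phi> (v i))"
  proof -
    have "val (s + \<Phi> \<gamma>) {..<k} (\<lambda>i. \<Phi> (v i)) e = s + \<Phi> (val \<gamma> {..<k} v e)" for e
      by (simp add: \<Phi>_val) (simp add: val_def add.assoc)
    then show ?thesis by (simp only: X piece_def setcompr_eq_image image_image)
  qed
  moreover have "(\<lambda>i. \<Phi> (v i)) ` {..<k} \<subseteq> H" using v H_digit by auto
  ultimately show ?case by metis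
next
  case (loop X z)
  then obtain \<gamma> k v where v: "v ` {..<k} \<subseteq> H" and X: "string_value \<Phi> ` X = piece \<gamma> k v" by blast
  obtain y where y: "z = concat (replicate (card core) y)" "length y = p" using loop.hyps(2) by blast
  \<comment> \<open>One block of \<open>z\<close> has value
    \<open>norm (string_value \<Phi> y)\<close>, and its length is \<open>M\<close>, so powers of
    \<open>z\<close> advance by powers of \<open>G\<close>.\<close>
  define w where "w = string_value \<Phi> z"
  have w: "w = norm (string_value \<Phi> y)"
    by (simp add: w_def y string_value_power[OF additive] norm_def)
  have len: "length z = M" by (simp add: y M_def length_concat sum_list_replicate mult.commute)
  have sv_loop: "string_value \<Phi> (concat (replicate n z) @ x) = cyc w n + (G ^^ n) (string_value \<Phi> x)" for n x
    by (simp add: string_value_append[OF additive] string_value_power[OF additive] len G_pow cyc_def w_def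
        length_concat sum_list_replicate mult.commute)
  have "string_value \<Phi> ` {concat (replicate n z) @ x | n x. x \<in> X}
    = {cyc w n + (G ^^ n) y | n y. y \<in> string_value \<Phi> ` X}"
  proof (intro equalityI subsetI)
    fix a assume "a \<in> string_value \<Phi> ` {concat (replicate n z) @ x | n x. x \<in> X}"
    then obtain n x where x: "x \<in> X" "a = string_value \<Phi> (concat (replicate n z) @ x)" by blast
    have "a = cyc w n + (G ^^ n) (string_value \<Phi> x)" using x(2) by (simp only: sv_loop)
    then show "a \<in> {cyc w n + (G ^^ n) y | n y. y \<in> string_value \<Phi> ` X}" using x(1) by blast
  next
    fix a assume "a \<in> {cyc w n + (G ^^ n) y | n y. y \<in> string_value \<Phi> ` X}"
    then obtain n x where x: "x \<in> X" "a = cyc w n + (G ^^ n) (string_value \<Phi> x)" by blast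
    have "a = string_value \<Phi> (concat (replicate n z) @ x)" using x(2) by (simp only: sv_loop)
    then show "a \<in> string_value \<Phi> ` {concat (replicate n z) @ x | n x. x \<in> X}" using x(1) by blast
  qed
  also have "\<dots> = piece \<gamma> (Suc k) (case_nat (w + (G \<gamma> - \<gamma>) - sum v {..<k}) v)"
    unfolding X by (rule piece_loop)
  finally have "string_value \<Phi> ` {concat (replicate n z) @ x | n x. x \<in> X}
    = piece \<gamma> (Suc k) (case_nat (w + (G \<gamma> - \<gamma>) - sum v {..<k}) v)" .
  moreover have "case_nat (w + (G \<gamma> - \<gamma>) - sum v {..<k}) v ` {..<Suc k} \<subseteq> H"
  proof -
    have "w + (G \<gamma> - \<gamma>) - sum v {..<k} \<in> H"
      unfolding w by (rule H_diff[OF H_add[OF H_norm G_minus_id_H] H_sum]) (use v in auto)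
    moreover have "v i \<in> H" if "Suc i < Suc k" for i using v that by (simp add: image_subset_iff)
    ultimately show ?thesis by (simp add: image_subset_iff split: nat.split)
  qed
  ultimately show ?case by (intro exI conjI)
qed

end

theorem theorem6p3:
  fixes F :: "'a::ab_group_add \<Rightarrow> 'a" and A :: "'a set"
  assumes "infinite (UNIV :: 'a set)"
    and "finitely_generated TYPE('a)"
    and "additive F"
    and "inj F"
    and "\<exists>r>0. \<exists>\<Sigma>. spanning_set (F ^^ r) \<Sigma>"
    and "F_sparse F A"
    and "stable_set A"
  shows "A \<in> boolean_combinations {B. groupless_F_set F B}"
proof -
  obtain r S L where r: "r > 0" and S: "spanning_set (F ^^ r) S" and L: "sparse_language S L"
    and A: "A = string_value (F ^^ r) ` L"
    using \<open>F_sparse F A\<close> unfolding F_sparse_def by (elim exE conjE) (rule that)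
  have "inj (F ^^ r)" using \<open>inj F\<close> by (rule inj_fn)
  interpret spanning "F ^^ r" S
    by (rule spanning.intro[OF additive_funpow[OF \<open>additive F\<close>] \<open>inj (F ^^ r)\<close> S])
  obtain p0 where p0: "p0 > 0" "\<And>x. x \<in> core \<Longrightarrow> ((F ^^ r) ^^ p0) x = x"
    using core_period by blast
  obtain d where d: "d > 0" and decomposition: "\<forall>p n. d dvd p \<longrightarrow> p > 0 \<longrightarrow> n > 0 \<longrightarrow> (\<exists>\<X>. finite \<X> \<and>
    \<X> \<subseteq> simple S {concat (replicate n z) | z. z \<in> lists S \<and> length z = p} \<and> L = \<Union>\<X>)"
    using sparse_decomposition[OF L] by (elim exE conjE) (rule that)
  \<comment> \<open>The loop length has to be a period of the core and a multiple of the automaton's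
    modulus at the same time.\<close>
  define p where "p = p0 * d"
  have p: "p > 0" "d dvd p" using p0(1) d by (simp_all add: p_def)
  have period: "((F ^^ r) ^^ p) x = x" if "x \<in> core" for x
  proof -
    have "p mod p0 = 0" by (simp add: p_def)
    then show ?thesis using funpow_mod_eq[OF p0(2)[OF that], of p] by simp
  qed
  interpret spanning_period "F ^^ r" S p
    by (rule spanning_period.intro[OF spanning_axioms spanning_period_axioms.intro[OF p(1) period]])
  have card_core: "card core > 0" using core_zero core_finite by (auto simp: card_gt_0_iff)
  obtain \<X> where \<X>: "finite \<X>"
    "\<X> \<subseteq> simple S {concat (replicate (card core) z) | z. z \<in> lists S \<and> length z = p}" "L = \<Union>\<X>"
    using decomposition[rule_format, OF p(2,1) card_core] by (elim exE conjE) (rule that)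
  let ?\<P> = "(\<lambda>X. string_value (F ^^ r) ` X) ` \<X>"
  have A_eq: "A = \<Union>?\<P>" unfolding A \<X>(3) by (simp only: image_Union)
  have "\<Union>?\<P> \<in> boolean_combinations {B. groupless_F_set F B}"
  proof (rule stable_pieces_boolean_combination)
    show "finite ?\<P>" using \<X>(1) by simp
    show "\<exists>\<gamma> k v. v ` {..<k} \<subseteq> H \<and> B = piece \<gamma> k v" if B: "B \<in> ?\<P>" for B
    proof -
      obtain X where "X \<in> \<X>" "B = string_value (F ^^ r) ` X" using B by blast
      then show ?thesis using simple_value_piece \<X>(2) by (simp only: subset_iff)
    qed
    show "stable_set (\<Union>?\<P>)" using \<open>stable_set A\<close> unfolding A_eq .
    show "box \<gamma> I v \<in> {B. groupless_F_set F B}" if "finite I" for \<gamma> I v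
    proof -
      have "G ^^ i = F ^^ (r * M * i)" for i by (simp add: G_pow funpow_mult mult.assoc)
      moreover have "r * M > 0" using r M_pos by simp
      ultimately show ?thesis using box_groupless[OF that] by blast
    qed
  qed
  then show ?thesis unfolding A_eq .
qed

end
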